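(* Work in $\mathbf{ZF}$ (Zermelo-Fraenkel set theory without the axiom of choice). Suppose that the quasi-isometry relation on metric spaces is symmetric, i.e. for all metric spaces $S$ and $T$, if there exists a quasi-isometry $S\to T$ then there exists a quasi-isometry $T\to S$. Then the axiom of choice holds.
   Context: The implication is to be derived from the axioms of $\mathbf{ZF}$ alone. Quasi-isometry: for metric spaces $(S,d_S)$ and $(T,d_T)$, a function $f:S\to T$ is a quasi-isometry if there exists a natural number $N\ge 1$ such that $B(f(S),N)=T$ and for all $x,y\in S$, $\frac1N d_S(x,y)-N\le d_T(f(x),f(y))\le N d_S(x,y)+N$. Here, for $J\subseteq T$, $B(J,p)=\{x\in T: d_T(x,J)\le p\}$ is the closed $p$-neighborhood (with $d_T(x,\emptyset)=+\infty$). Axiom of choice (formulation): if $\mathcal Z$ is a nonempty set consisting of pairwise disjoint nonempty sets, then there exists a set $A$ such that $A\cap X$ has cardinality one for all $X\in\mathcal Z$. *)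

theory Defs
  imports Main
begin

section \<open>First-order logic with equality over one binary predicate\<close>

text \<open>Variables are de Bruijn indices. There are no function symbols, so the only terms are
  variables, and substitution is renaming.\<close>

datatype fm = Mem nat nat | Eq nat nat | Falsum | Imp fm fm | Forall fm

primrec ren :: "(nat \<Rightarrow> nat) \<Rightarrow> fm \<Rightarrow> fm" where
  "ren r (Mem i j) = Mem (r i) (r j)"
| "ren r (Eq i j) = Eq (r i) (r j)"
| "ren r Falsum = Falsum"
| "ren r (Imp p q) = Imp (ren r p) (ren r q)"
| "ren r (Forall p) = Forall (ren (case_nat 0 (\<lambda>i. Suc (r i))) p)"

definition lift :: "fm \<Rightarrow> fm" where
  "lift = ren Suc"

definition inst :: "fm \<Rightarrow> nat \<Rightarrow> fm" where
  "inst p t = ren (case_nat t id) p"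

text \<open>Classical natural deduction. Contexts may be infinite.\<close>

inductive deriv :: "fm set \<Rightarrow> fm \<Rightarrow> bool" (infix "\<turnstile>" 5) where
  assm: "p \<in> G \<Longrightarrow> G \<turnstile> p"
| impI: "insert p G \<turnstile> q \<Longrightarrow> G \<turnstile> Imp p q"
| impE: "G \<turnstile> Imp p q \<Longrightarrow> G \<turnstile> p \<Longrightarrow> G \<turnstile> q"
| raa: "insert (Imp p Falsum) G \<turnstile> Falsum \<Longrightarrow> G \<turnstile> p"
| allI: "lift ` G \<turnstile> p \<Longrightarrow> G \<turnstile> Forall p"
| allE: "G \<turnstile> Forall p \<Longrightarrow> G \<turnstile> inst p t"
| eq_refl: "G \<turnstile> Eq t t"
| eq_subst: "G \<turnstile> Eq s t \<Longrightarrow> G \<turnstile> inst p s \<Longrightarrow> G \<turnstile> inst p t"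

primrec free_bound :: "fm \<Rightarrow> nat" where
  "free_bound (Mem i j) = max (Suc i) (Suc j)"
| "free_bound (Eq i j) = max (Suc i) (Suc j)"
| "free_bound Falsum = 0"
| "free_bound (Imp p q) = max (free_bound p) (free_bound q)"
| "free_bound (Forall p) = free_bound p - 1"

definition closure :: "fm \<Rightarrow> fm" where
  "closure p = (Forall ^^ free_bound p) p"


section \<open>Writing formulas with named variables\<close>

text \<open>A \<open>form\<close> is a formula that still has to be told the number \<open>d\<close> of quantifiers
  above it. A quantifier at depth \<open>d\<close> hands the level \<open>d\<close> to its body as the name of its variable;
  at depth \<open>d\<close>, level \<open>x < d\<close> is the index \<open>d - Suc x\<close>. So HOL-bound variables
  serve as the variables of the object language, and applying a closed \<open>form\<close> to \<open>0\<close>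
  yields an ordinary sentence.\<close>

type_synonym var = nat
type_synonym form = "nat \<Rightarrow> fm"

definition sentence :: "form \<Rightarrow> fm" where
  "sentence F = F 0"

definition f_mem :: "var \<Rightarrow> var \<Rightarrow> form" (infix "\<^bold>\<in>" 50) where
  "x \<^bold>\<in> y = (\<lambda>d. Mem (d - Suc x) (d - Suc y))"

definition f_eq :: "var \<Rightarrow> var \<Rightarrow> form" (infix "\<^bold>=" 50) where
  "x \<^bold>= y = (\<lambda>d. Eq (d - Suc x) (d - Suc y))"

definition f_imp :: "form \<Rightarrow> form \<Rightarrow> form" (infixr "\<^bold>\<longrightarrow>" 25) where
  "(F \<^bold>\<longrightarrow> G) = (\<lambda>d. Imp (F d) (G d))"

definition f_not :: "form \<Rightarrow> form" ("\<^bold>\<not> _" [40] 40) where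
  "(\<^bold>\<not> F) = (\<lambda>d. Imp (F d) Falsum)"

definition f_and :: "form \<Rightarrow> form \<Rightarrow> form" (infixr "\<^bold>\<and>" 35) where
  "(F \<^bold>\<and> G) = (\<^bold>\<not> (F \<^bold>\<longrightarrow> \<^bold>\<not> G))"

definition f_or :: "form \<Rightarrow> form \<Rightarrow> form" (infixr "\<^bold>\<or>" 30) where
  "(F \<^bold>\<or> G) = (\<^bold>\<not> F \<^bold>\<longrightarrow> G)"

definition f_iff :: "form \<Rightarrow> form \<Rightarrow> form" (infixr "\<^bold>\<longleftrightarrow>" 25) where
  "(F \<^bold>\<longleftrightarrow> G) = ((F \<^bold>\<longrightarrow> G) \<^bold>\<and> (G \<^bold>\<longrightarrow> F))"

definition f_all :: "(var \<Rightarrow> form) \<Rightarrow> form" (binder "\<^bold>\<forall>" 10) where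
  "f_all F = (\<lambda>d. Forall (F d (Suc d)))"

definition f_ex :: "(var \<Rightarrow> form) \<Rightarrow> form" (binder "\<^bold>\<exists>" 10) where
  "(\<^bold>\<exists>x. F x) = (\<^bold>\<not> (\<^bold>\<forall>x. \<^bold>\<not> F x))"

definition f_ball :: "var \<Rightarrow> (var \<Rightarrow> form) \<Rightarrow> form" where
  "f_ball A F = (\<^bold>\<forall>x. x \<^bold>\<in> A \<^bold>\<longrightarrow> F x)"

definition f_bex :: "var \<Rightarrow> (var \<Rightarrow> form) \<Rightarrow> form" where
  "f_bex A F = (\<^bold>\<exists>x. x \<^bold>\<in> A \<^bold>\<and> F x)"

syntax
  "_f_ball" :: "pttrn \<Rightarrow> var \<Rightarrow> form \<Rightarrow> form" ("(3\<^bold>\<forall>_\<^bold>\<in>_./ _)" [0, 0, 10] 10)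
  "_f_bex" :: "pttrn \<Rightarrow> var \<Rightarrow> form \<Rightarrow> form" ("(3\<^bold>\<exists>_\<^bold>\<in>_./ _)" [0, 0, 10] 10)
translations
  "\<^bold>\<forall>x\<^bold>\<in>A. F" \<rightleftharpoons> "CONST f_ball A (\<lambda>x. F)"
  "\<^bold>\<exists>x\<^bold>\<in>A. F" \<rightleftharpoons> "CONST f_bex A (\<lambda>x. F)"

text \<open>\<open>at1 p x\<close> is \<open>p\<close> with index \<open>0\<close> replaced by the variable \<open>x\<close>, and
  \<open>at2 p x y\<close> is \<open>p\<close> with indices \<open>0\<close> and \<open>1\<close> replaced by \<open>x\<close> and \<open>y\<close>. The remaining
  indices are parameters; they point beyond all the quantifiers of the surrounding form.\<close>

definition at1 :: "fm \<Rightarrow> var \<Rightarrow> form" where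
  "at1 p x = (\<lambda>d. ren (case_nat (d - Suc x) (\<lambda>k. d + k)) p)"

definition at2 :: "fm \<Rightarrow> var \<Rightarrow> var \<Rightarrow> form" where
  "at2 p x y = (\<lambda>d. ren (case_nat (d - Suc x) (case_nat (d - Suc y) (\<lambda>k. d + k))) p)"


section \<open>The axioms of ZF\<close>

definition extensionality :: fm where
  "extensionality = sentence (\<^bold>\<forall>x y. (\<^bold>\<forall>z. z \<^bold>\<in> x \<^bold>\<longleftrightarrow> z \<^bold>\<in> y) \<^bold>\<longrightarrow> x \<^bold>= y)"

definition foundation :: fm where
  "foundation = sentence (\<^bold>\<forall>x. (\<^bold>\<exists>y. y \<^bold>\<in> x) \<^bold>\<longrightarrow> (\<^bold>\<exists>y\<^bold>\<in>x. \<^bold>\<not> (\<^bold>\<exists>z\<^bold>\<in>y. z \<^bold>\<in> x)))"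

definition pairing :: fm where
  "pairing = sentence (\<^bold>\<forall>x y. \<^bold>\<exists>u. \<^bold>\<forall>z. z \<^bold>\<in> u \<^bold>\<longleftrightarrow> z \<^bold>= x \<^bold>\<or> z \<^bold>= y)"

definition union :: fm where
  "union = sentence (\<^bold>\<forall>x. \<^bold>\<exists>u. \<^bold>\<forall>z. z \<^bold>\<in> u \<^bold>\<longleftrightarrow> (\<^bold>\<exists>y\<^bold>\<in>x. z \<^bold>\<in> y))"

definition power_set :: fm where
  "power_set = sentence (\<^bold>\<forall>x. \<^bold>\<exists>u. \<^bold>\<forall>z. z \<^bold>\<in> u \<^bold>\<longleftrightarrow> (\<^bold>\<forall>w\<^bold>\<in>z. w \<^bold>\<in> x))"

definition infinity :: fm where
  "infinity = sentence (\<^bold>\<exists>w. (\<^bold>\<exists>e\<^bold>\<in>w. \<^bold>\<forall>z. \<^bold>\<not> z \<^bold>\<in> e) \<^bold>\<and>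
     (\<^bold>\<forall>x\<^bold>\<in>w. \<^bold>\<exists>y\<^bold>\<in>w. \<^bold>\<forall>z. z \<^bold>\<in> y \<^bold>\<longleftrightarrow> z \<^bold>\<in> x \<^bold>\<or> z \<^bold>= x))"

definition separation :: "fm \<Rightarrow> fm" where
  "separation p = closure (sentence (\<^bold>\<forall>a. \<^bold>\<exists>b. \<^bold>\<forall>x. x \<^bold>\<in> b \<^bold>\<longleftrightarrow> x \<^bold>\<in> a \<^bold>\<and> at1 p x))"

definition replacement :: "fm \<Rightarrow> fm" where
  "replacement p = closure (sentence (\<^bold>\<forall>a.
     (\<^bold>\<forall>x\<^bold>\<in>a. \<^bold>\<forall>y z. at2 p x y \<^bold>\<and> at2 p x z \<^bold>\<longrightarrow> y \<^bold>= z) \<^bold>\<longrightarrow>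
     (\<^bold>\<exists>b. \<^bold>\<forall>y. y \<^bold>\<in> b \<^bold>\<longleftrightarrow> (\<^bold>\<exists>x\<^bold>\<in>a. at2 p x y))))"

definition ZF :: "fm set" where
  "ZF = {extensionality, foundation, pairing, union, power_set, infinity}
    \<union> range separation \<union> range replacement"


section \<open>Terms, pairs and functions\<close>

text \<open>A term is given by its graph: \<open>s v\<close> is the formula saying that \<open>v\<close> is the value
  of \<open>s\<close>. An atomic formula with terms as arguments holds if the arguments have values that
  satisfy it; in particular it fails if an argument has no value.\<close>

type_synonym trm = "var \<Rightarrow> form"

definition V :: "var \<Rightarrow> trm" where
  "V x = (\<lambda>v. v \<^bold>= x)"

definition t_eq :: "trm \<Rightarrow> trm \<Rightarrow> form" (infix "\<^bold>\<simeq>" 50) where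
  "s \<^bold>\<simeq> t = (\<^bold>\<exists>v. s v \<^bold>\<and> t v)"

definition upair :: "trm \<Rightarrow> trm \<Rightarrow> trm" where
  "upair s t = (\<lambda>v. \<^bold>\<exists>x y. s x \<^bold>\<and> t y \<^bold>\<and> (\<^bold>\<forall>z. z \<^bold>\<in> v \<^bold>\<longleftrightarrow> z \<^bold>= x \<^bold>\<or> z \<^bold>= y))"

definition opair :: "trm \<Rightarrow> trm \<Rightarrow> trm" where
  "opair s t = upair (upair s s) (upair s t)"

definition related :: "var \<Rightarrow> trm \<Rightarrow> trm \<Rightarrow> form" where
  "related r s t = (\<^bold>\<exists>p\<^bold>\<in>r. opair s t p)"

definition app :: "var \<Rightarrow> trm \<Rightarrow> trm" where
  "app f s = (\<lambda>v. related f s (V v))"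

definition app2 :: "var \<Rightarrow> trm \<Rightarrow> trm \<Rightarrow> trm" where
  "app2 f s t = app f (opair s t)"

definition cartesian :: "var \<Rightarrow> var \<Rightarrow> trm" where
  "cartesian A B = (\<lambda>v. \<^bold>\<forall>p. p \<^bold>\<in> v \<^bold>\<longleftrightarrow> (\<^bold>\<exists>a\<^bold>\<in>A. \<^bold>\<exists>b\<^bold>\<in>B. opair (V a) (V b) p))"

definition maps :: "var \<Rightarrow> var \<Rightarrow> var \<Rightarrow> form" where
  "maps f A B =
     ((\<^bold>\<forall>p\<^bold>\<in>f. \<^bold>\<exists>x\<^bold>\<in>A. \<^bold>\<exists>y\<^bold>\<in>B. opair (V x) (V y) p) \<^bold>\<and>
      (\<^bold>\<forall>x\<^bold>\<in>A. \<^bold>\<exists>y. \<^bold>\<forall>z. related f (V x) (V z) \<^bold>\<longleftrightarrow> z \<^bold>= y))"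

definition maps2 :: "var \<Rightarrow> var \<Rightarrow> var \<Rightarrow> var \<Rightarrow> form" where
  "maps2 f A B C = (\<^bold>\<exists>P. cartesian A B P \<^bold>\<and> maps f P C)"

definition image_of :: "var \<Rightarrow> var \<Rightarrow> trm" where
  "image_of f A = (\<lambda>v. \<^bold>\<forall>y. y \<^bold>\<in> v \<^bold>\<longleftrightarrow> (\<^bold>\<exists>x\<^bold>\<in>A. related f (V x) (V y)))"


section \<open>The real numbers\<close>

text \<open>The reals are any complete ordered field inside the universe of sets: variables for the
  carrier, addition, multiplication, order (a set of ordered pairs), zero and one. ZF proves
  that such a field exists and that any two of them are isomorphic.\<close>

datatype reals = Reals (carrier: var) (add: var) (mul: var) (leq: var) (zero: var) (one: var)

definition r_add :: "trm \<Rightarrow> reals \<Rightarrow> trm \<Rightarrow> trm" ("(_ \<oplus>\<^bsub>_\<^esub> _)" [65, 0, 66] 65) where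
  "s \<oplus>\<^bsub>K\<^esub> t = app2 (add K) s t"

definition r_mul :: "trm \<Rightarrow> reals \<Rightarrow> trm \<Rightarrow> trm" ("(_ \<otimes>\<^bsub>_\<^esub> _)" [70, 0, 71] 70) where
  "s \<otimes>\<^bsub>K\<^esub> t = app2 (mul K) s t"

definition r_diff :: "trm \<Rightarrow> reals \<Rightarrow> trm \<Rightarrow> trm" ("(_ \<ominus>\<^bsub>_\<^esub> _)" [65, 0, 66] 65) where
  "s \<ominus>\<^bsub>K\<^esub> t = (\<lambda>v. V v \<oplus>\<^bsub>K\<^esub> t \<^bold>\<simeq> s)"

definition r_inv :: "reals \<Rightarrow> trm \<Rightarrow> trm" where
  "r_inv K s = (\<lambda>v. V v \<otimes>\<^bsub>K\<^esub> s \<^bold>\<simeq> V (one K))"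

definition r_le :: "trm \<Rightarrow> reals \<Rightarrow> trm \<Rightarrow> form" ("(_ \<preceq>\<^bsub>_\<^esub> _)" [51, 0, 51] 50) where
  "s \<preceq>\<^bsub>K\<^esub> t = related (leq K) s t"

definition field_axioms :: "reals \<Rightarrow> form" where
  "field_axioms K = (let R = carrier K; o0 = V (zero K); o1 = V (one K) in
     maps2 (add K) R R R \<^bold>\<and> maps2 (mul K) R R R \<^bold>\<and>
     zero K \<^bold>\<in> R \<^bold>\<and> one K \<^bold>\<in> R \<^bold>\<and> \<^bold>\<not> zero K \<^bold>= one K \<^bold>\<and>
     (\<^bold>\<forall>x\<^bold>\<in>R. \<^bold>\<forall>y\<^bold>\<in>R. \<^bold>\<forall>z\<^bold>\<in>R.
        (V x \<oplus>\<^bsub>K\<^esub> V y) \<oplus>\<^bsub>K\<^esub> V z \<^bold>\<simeq> V x \<oplus>\<^bsub>K\<^esub> (V y \<oplus>\<^bsub>K\<^esub> V z) \<^bold>\<and>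
        (V x \<otimes>\<^bsub>K\<^esub> V y) \<otimes>\<^bsub>K\<^esub> V z \<^bold>\<simeq> V x \<otimes>\<^bsub>K\<^esub> (V y \<otimes>\<^bsub>K\<^esub> V z) \<^bold>\<and>
        V x \<otimes>\<^bsub>K\<^esub> (V y \<oplus>\<^bsub>K\<^esub> V z) \<^bold>\<simeq> V x \<otimes>\<^bsub>K\<^esub> V y \<oplus>\<^bsub>K\<^esub> V x \<otimes>\<^bsub>K\<^esub> V z) \<^bold>\<and>
     (\<^bold>\<forall>x\<^bold>\<in>R. \<^bold>\<forall>y\<^bold>\<in>R.
        V x \<oplus>\<^bsub>K\<^esub> V y \<^bold>\<simeq> V y \<oplus>\<^bsub>K\<^esub> V x \<^bold>\<and> V x \<otimes>\<^bsub>K\<^esub> V y \<^bold>\<simeq> V y \<otimes>\<^bsub>K\<^esub> V x) \<^bold>\<and>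
     (\<^bold>\<forall>x\<^bold>\<in>R. V x \<oplus>\<^bsub>K\<^esub> o0 \<^bold>\<simeq> V x \<^bold>\<and> V x \<otimes>\<^bsub>K\<^esub> o1 \<^bold>\<simeq> V x) \<^bold>\<and>
     (\<^bold>\<forall>x\<^bold>\<in>R. \<^bold>\<exists>y\<^bold>\<in>R. V x \<oplus>\<^bsub>K\<^esub> V y \<^bold>\<simeq> o0) \<^bold>\<and>
     (\<^bold>\<forall>x\<^bold>\<in>R. \<^bold>\<not> x \<^bold>= zero K \<^bold>\<longrightarrow> (\<^bold>\<exists>y\<^bold>\<in>R. V x \<otimes>\<^bsub>K\<^esub> V y \<^bold>\<simeq> o1)))"

definition order_axioms :: "reals \<Rightarrow> form" where
  "order_axioms K = (let R = carrier K; o0 = V (zero K) in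
     (\<^bold>\<forall>x\<^bold>\<in>R. \<^bold>\<forall>y\<^bold>\<in>R. V x \<preceq>\<^bsub>K\<^esub> V y \<^bold>\<or> V y \<preceq>\<^bsub>K\<^esub> V x) \<^bold>\<and>
     (\<^bold>\<forall>x\<^bold>\<in>R. \<^bold>\<forall>y\<^bold>\<in>R. V x \<preceq>\<^bsub>K\<^esub> V y \<^bold>\<and> V y \<preceq>\<^bsub>K\<^esub> V x \<^bold>\<longrightarrow> x \<^bold>= y) \<^bold>\<and>
     (\<^bold>\<forall>x\<^bold>\<in>R. \<^bold>\<forall>y\<^bold>\<in>R. \<^bold>\<forall>z\<^bold>\<in>R.
        V x \<preceq>\<^bsub>K\<^esub> V y \<^bold>\<and> V y \<preceq>\<^bsub>K\<^esub> V z \<^bold>\<longrightarrow> V x \<preceq>\<^bsub>K\<^esub> V z) \<^bold>\<and>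
     (\<^bold>\<forall>x\<^bold>\<in>R. \<^bold>\<forall>y\<^bold>\<in>R. \<^bold>\<forall>z\<^bold>\<in>R.
        V x \<preceq>\<^bsub>K\<^esub> V y \<^bold>\<longrightarrow> V x \<oplus>\<^bsub>K\<^esub> V z \<preceq>\<^bsub>K\<^esub> V y \<oplus>\<^bsub>K\<^esub> V z) \<^bold>\<and>
     (\<^bold>\<forall>x\<^bold>\<in>R. \<^bold>\<forall>y\<^bold>\<in>R.
        o0 \<preceq>\<^bsub>K\<^esub> V x \<^bold>\<and> o0 \<preceq>\<^bsub>K\<^esub> V y \<^bold>\<longrightarrow> o0 \<preceq>\<^bsub>K\<^esub> V x \<otimes>\<^bsub>K\<^esub> V y))"

definition completeness_axiom :: "reals \<Rightarrow> form" where
  "completeness_axiom K = (let R = carrier K; ub = (\<lambda>A b. \<^bold>\<forall>x\<^bold>\<in>A. V x \<preceq>\<^bsub>K\<^esub> V b) in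
     \<^bold>\<forall>A. (\<^bold>\<forall>x\<^bold>\<in>A. x \<^bold>\<in> R) \<^bold>\<and> (\<^bold>\<exists>x. x \<^bold>\<in> A) \<^bold>\<and> (\<^bold>\<exists>b\<^bold>\<in>R. ub A b) \<^bold>\<longrightarrow>
       (\<^bold>\<exists>s\<^bold>\<in>R. ub A s \<^bold>\<and> (\<^bold>\<forall>b\<^bold>\<in>R. ub A b \<^bold>\<longrightarrow> V s \<preceq>\<^bsub>K\<^esub> V b)))"

definition complete_ordered_field :: "reals \<Rightarrow> form" where
  "complete_ordered_field K = (field_axioms K \<^bold>\<and> order_axioms K \<^bold>\<and> completeness_axiom K)"

text \<open>The natural numbers \<open>\<ge> 1\<close>, as the least subset of the reals that contains \<open>1\<close>
  and is closed under \<open>x \<mapsto> x + 1\<close>.\<close>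

definition positive_natural :: "reals \<Rightarrow> var \<Rightarrow> form" where
  "positive_natural K n = (n \<^bold>\<in> carrier K \<^bold>\<and>
     (\<^bold>\<forall>I. (\<^bold>\<forall>x\<^bold>\<in>I. x \<^bold>\<in> carrier K) \<^bold>\<and> one K \<^bold>\<in> I \<^bold>\<and>
          (\<^bold>\<forall>x\<^bold>\<in>I. \<^bold>\<exists>y\<^bold>\<in>I. V y \<^bold>\<simeq> V x \<oplus>\<^bsub>K\<^esub> V (one K)) \<^bold>\<longrightarrow> n \<^bold>\<in> I))"


section \<open>Metric spaces and quasi-isometries\<close>

definition metric_space :: "reals \<Rightarrow> var \<Rightarrow> var \<Rightarrow> form" where
  "metric_space K S d = (let o0 = V (zero K); dist = (\<lambda>x y. app2 d (V x) (V y)) in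
     maps2 d S S (carrier K) \<^bold>\<and>
     (\<^bold>\<forall>x\<^bold>\<in>S. \<^bold>\<forall>y\<^bold>\<in>S.
        o0 \<preceq>\<^bsub>K\<^esub> dist x y \<^bold>\<and> (dist x y \<^bold>\<simeq> o0 \<^bold>\<longleftrightarrow> x \<^bold>= y) \<^bold>\<and> dist x y \<^bold>\<simeq> dist y x) \<^bold>\<and>
     (\<^bold>\<forall>x\<^bold>\<in>S. \<^bold>\<forall>y\<^bold>\<in>S. \<^bold>\<forall>z\<^bold>\<in>S. dist x z \<preceq>\<^bsub>K\<^esub> dist x y \<oplus>\<^bsub>K\<^esub> dist y z))"

text \<open>The distance of a point from a set \<open>J\<close> is an infimum. For empty \<open>J\<close> it has no value,
  since every real is then a lower bound; so the closed neighbourhoods of the empty set are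
  empty, in accordance with the convention that this distance is infinite.\<close>

definition set_dist :: "reals \<Rightarrow> var \<Rightarrow> var \<Rightarrow> var \<Rightarrow> trm" where
  "set_dist K d x J = (let lb = (\<lambda>r. \<^bold>\<forall>y\<^bold>\<in>J. V r \<preceq>\<^bsub>K\<^esub> app2 d (V x) (V y)) in
     (\<lambda>r. r \<^bold>\<in> carrier K \<^bold>\<and> lb r \<^bold>\<and> (\<^bold>\<forall>s\<^bold>\<in>carrier K. lb s \<^bold>\<longrightarrow> V s \<preceq>\<^bsub>K\<^esub> V r)))"

definition neighbourhood :: "reals \<Rightarrow> var \<Rightarrow> var \<Rightarrow> var \<Rightarrow> var \<Rightarrow> trm" where
  "neighbourhood K T d J p =
     (\<lambda>B. \<^bold>\<forall>x. x \<^bold>\<in> B \<^bold>\<longleftrightarrow> x \<^bold>\<in> T \<^bold>\<and> set_dist K d x J \<preceq>\<^bsub>K\<^esub> V p)"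

definition quasi_isometry :: "reals \<Rightarrow> var \<Rightarrow> var \<Rightarrow> var \<Rightarrow> var \<Rightarrow> var \<Rightarrow> form" where
  "quasi_isometry K S d T e f = (maps f S T \<^bold>\<and>
     (\<^bold>\<exists>N. positive_natural K N \<^bold>\<and>
       (\<^bold>\<exists>J. image_of f S J \<^bold>\<and> neighbourhood K T e J N \<^bold>\<simeq> V T) \<^bold>\<and>
       (\<^bold>\<forall>x\<^bold>\<in>S. \<^bold>\<forall>y\<^bold>\<in>S.
          let dS = app2 d (V x) (V y); dT = app2 e (app f (V x)) (app f (V y)) in
            r_inv K (V N) \<otimes>\<^bsub>K\<^esub> dS \<ominus>\<^bsub>K\<^esub> V N \<preceq>\<^bsub>K\<^esub> dT \<^bold>\<and>
            dT \<preceq>\<^bsub>K\<^esub> V N \<otimes>\<^bsub>K\<^esub> dS \<oplus>\<^bsub>K\<^esub> V N)))"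

definition quasi_isometry_symmetric :: "reals \<Rightarrow> form" where
  "quasi_isometry_symmetric K = (\<^bold>\<forall>S d T e. metric_space K S d \<^bold>\<and> metric_space K T e \<^bold>\<longrightarrow>
     (\<^bold>\<exists>f. quasi_isometry K S d T e f) \<^bold>\<longrightarrow> (\<^bold>\<exists>g. quasi_isometry K T e S d g))"


section \<open>The axiom of choice\<close>

definition axiom_of_choice :: form where
  "axiom_of_choice = (\<^bold>\<forall>Z. (\<^bold>\<exists>X. X \<^bold>\<in> Z) \<^bold>\<and> (\<^bold>\<forall>X\<^bold>\<in>Z. \<^bold>\<exists>x. x \<^bold>\<in> X) \<^bold>\<and>
       (\<^bold>\<forall>X\<^bold>\<in>Z. \<^bold>\<forall>Y\<^bold>\<in>Z. \<^bold>\<not> X \<^bold>= Y \<^bold>\<longrightarrow> \<^bold>\<not> (\<^bold>\<exists>x\<^bold>\<in>X. x \<^bold>\<in> Y)) \<^bold>\<longrightarrow>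
     (\<^bold>\<exists>A. \<^bold>\<forall>X\<^bold>\<in>Z. \<^bold>\<exists>a. \<^bold>\<forall>x. x \<^bold>\<in> A \<^bold>\<and> x \<^bold>\<in> X \<^bold>\<longleftrightarrow> x \<^bold>= a))"

end

(* A nonderivation yields a countable model: the Henkin construction takes the variables themselves as
   witnesses, and Russell's paradox makes a model of ZF infinite, so that it can be carried by nat with
   true equality. It remains to argue inside a model.

   Let Z be a family of disjoint nonempty sets and L the set of reals r >= 1. Let T be Z x L, where
   distinct points (X,r), (Y,s) have distance max r s, and let S be (UN Z) x L with the same distance
   between points of different fibres of the projection S -> T and distance 1 within a fibre. The
   projection is a quasi-isometry. Let g : T -> S be a quasi-isometry with constant n. A fibre over
   (X,r) with r >= n + 1 is more than n away from everything else, so g hits it. If g maps two points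
   to the same fibre, both have level at most c = n(1+n); since g maps all points of level at most c
   into one bounded region, this happens for at most one fibre of level above m = nc+n. Hence at some
   level h every fibre contains g t for exactly one t, and these values choose from Z. *)
theory Submission
  imports Defs "HOL-Library.Countable_Set"
begin

section \<open>Renaming and derivations\<close>

text \<open>The obstacle is that HOL itself has choice, which must not leak into the model. Choice
  in HOL may name points, but a subset of a point exists only by separation along a formula with
  parameters; hence \<open>definable\<close>, through which the subsets, functions and metrics of
  the argument are built. The model is countable seen from HOL, so its reals are not those of HOL,
  and the ordered-field arithmetic is proved for the members of \<open>R\<close>. The levels are
  there because the constant of \<open>g\<close> is not known in advance: a space with a single
  scale could be swallowed by it, whereas unbounded levels provide, beyond every constant, fibres
  that are isolated and still of diameter at most one. The map \<open>g\<close> need not invert the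
  projection, and its value at \<open>(X,h)\<close> may lie over another member of \<open>Z\<close>.
  So nothing can be read off at \<open>(X,h)\<close>; the choice is read off from the image of
  \<open>g\<close>, which takes existence and uniqueness of the hit in each fibre of one common
  level.\<close>

lemma ren_cong: "(\<And>i. i < free_bound p \<Longrightarrow> r i = s i) \<Longrightarrow> ren r p = ren s p"
proof (induction p arbitrary: r s)
  case (Forall p)
  have "ren (case_nat 0 (\<lambda>i. Suc (r i))) p = ren (case_nat 0 (\<lambda>i. Suc (s i))) p"
    using Forall.prems by (intro Forall.IH) (auto split: nat.split)
  then show ?case by simp
next
  case (Imp p q)
  have "ren r p = ren s p" "ren r q = ren s q"
    using Imp.prems by (auto intro!: Imp.IH)
  then show ?case by simp
qed auto

lemma ren_ren: "ren r (ren s p) = ren (\<lambda>i. r (s i)) p"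
proof (induction p arbitrary: r s)
  case (Forall p)
  have "(\<lambda>i. case_nat 0 (\<lambda>i. Suc (r i)) (case_nat 0 (\<lambda>i. Suc (s i)) i))
      = case_nat 0 (\<lambda>i. Suc (r (s i)))"
    by (auto split: nat.split)
  then show ?case by (simp add: Forall)
qed auto

lemma ren_ident [simp]: "ren (\<lambda>i. i) p = p"
proof (induction p)
  case (Forall p)
  have "case_nat 0 Suc = (\<lambda>i. i)" by (auto split: nat.split)
  then show ?case by (simp add: Forall)
qed auto

lemma ren_inst: "ren r (inst p t) = inst (ren (case_nat 0 (\<lambda>i. Suc (r i))) p) (r t)"
  by (auto simp: inst_def ren_ren intro!: ren_cong split: nat.split)

lemma free_bound_ren: "(\<And>i. i < free_bound p \<Longrightarrow> r i < b) \<Longrightarrow> free_bound (ren r p) \<le> b"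
proof (induction p arbitrary: r b)
  case (Forall p)
  have "free_bound (ren (case_nat 0 (\<lambda>i. Suc (r i))) p) \<le> Suc b"
    using Forall.prems by (intro Forall.IH) (auto split: nat.split)
  then show ?case by simp
qed (auto simp: Suc_le_eq)

lemma deriv_mono: "G \<turnstile> p \<Longrightarrow> G \<subseteq> H \<Longrightarrow> H \<turnstile> p"
proof (induction arbitrary: H rule: deriv.induct)
  case (impI p G q)
  then show ?case by (meson deriv.impI insert_mono)
next
  case (raa p G)
  then show ?case by (meson deriv.raa insert_mono)
next
  case (allI G p)
  then show ?case by (meson deriv.allI image_mono)
next
  case (impE G p q)
  show ?case by (rule deriv.impE[OF impE.IH]) (fact impE.prems)+
next
  case (eq_subst G s t p)
  show ?case by (rule deriv.eq_subst[OF eq_subst.IH]) (fact eq_subst.prems)+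
qed (auto intro: deriv.assm deriv.eq_refl deriv.allE)

text \<open>In the quantifier case the renaming shifted under the binder commutes with
  \<open>lift\<close>, so it acts on the lifted context. \<open>deriv_generalize\<close> uses this
  with a renaming that sends a fresh variable to the bound position.\<close>

lemma deriv_ren: "G \<turnstile> p \<Longrightarrow> ren r ` G \<turnstile> ren r p"
proof (induction arbitrary: r rule: deriv.induct)
  case (impI p G q)
  then show ?case using deriv.impI by simp
next
  case (impE G p q)
  then show ?case using deriv.impE[of _ "ren r p" "ren r q"] by simp
next
  case (raa p G)
  then show ?case using deriv.raa[of "ren r p"] by simp
next
  case (allI G p)
  have "ren (case_nat 0 (\<lambda>i. Suc (r i))) ` lift ` G = lift ` ren r ` G"
    by (simp add: image_image lift_def ren_ren)
  then show ?case using allI.IH deriv.allI by simp metis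
next
  case (allE G p t)
  then show ?case by (simp add: ren_inst deriv.allE)
next
  case (eq_subst G s t p)
  then show ?case using deriv.eq_subst[of _ "r s" "r t"] by (simp add: ren_inst)
qed (auto intro: deriv.assm deriv.eq_refl)

text \<open>Carries consistency over to the union of the Henkin chain. Where a rule discharges a
  formula, it is removed from the finite part; in the quantifier rule the finite part is pulled back
  along \<open>lift\<close>.\<close>

lemma deriv_finite: "G \<turnstile> p \<Longrightarrow> \<exists>F. finite F \<and> F \<subseteq> G \<and> (F \<turnstile> p)"
proof (induction rule: deriv.induct)
  case (assm p G)
  then show ?case by (intro exI[of _ "{p}"]) (auto intro: deriv.assm)
next
  case (impI p G q)
  then obtain F where F: "finite F" "F \<subseteq> insert p G" "F \<turnstile> q" by blast
  then have "insert p (F - {p}) \<turnstile> q" by (auto intro: deriv_mono)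
  with F show ?case by (intro exI[of _ "F - {p}"]) (auto intro: deriv.impI)
next
  case (raa p G)
  then obtain F where F: "finite F" "F \<subseteq> insert (Imp p Falsum) G" "F \<turnstile> Falsum" by blast
  then have "insert (Imp p Falsum) (F - {Imp p Falsum}) \<turnstile> Falsum" by (auto intro: deriv_mono)
  with F show ?case by (intro exI[of _ "F - {Imp p Falsum}"]) (auto intro: deriv.raa)
next
  case (allI G p)
  then obtain F where F: "finite F" "F \<subseteq> lift ` G" "F \<turnstile> p" by blast
  then obtain F' where "F' \<subseteq> G" "finite F'" "F = lift ` F'"
    by (meson finite_subset_image)
  with F show ?case by (auto intro: deriv.allI)
next
  case (impE G p q)
  then obtain F F' where "finite F" "F \<subseteq> G" "F \<turnstile> Imp p q" "finite F'" "F' \<subseteq> G" "F' \<turnstile> p" by blast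
  then show ?case
    by (intro exI[of _ "F \<union> F'"] conjI deriv.impE[of _ p q]) (auto elim: deriv_mono)
next
  case (eq_subst G s t p)
  then obtain F F' where "finite F" "F \<subseteq> G" "F \<turnstile> Eq s t" "finite F'" "F' \<subseteq> G" "F' \<turnstile> inst p s" by blast
  then show ?case
    by (intro exI[of _ "F \<union> F'"] conjI deriv.eq_subst[of _ s t]) (auto elim: deriv_mono)
next
  case (allE G p t)
  then show ?case by (blast intro: deriv.allE)
next
  case (eq_refl G t)
  then show ?case by (intro exI[of _ "{}"]) (auto intro: deriv.eq_refl)
qed

text \<open>The bounds make index \<open>t\<close> fresh for \<open>G\<close> and for
  \<open>Forall p\<close>, so what is derived about \<open>t\<close> is derived about an arbitrary
  object.\<close>

lemma deriv_generalize:
  assumes "G \<turnstile> inst p t" "\<forall>q\<in>G. free_bound q \<le> t" "free_bound p \<le> Suc t"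
  shows "G \<turnstile> Forall p"
proof -
  \<comment> \<open>On formulas with free indices below \<open>t\<close> this agrees with
    \<open>lift\<close>, and applied after \<open>inst p t\<close> it restores
    \<open>p\<close>.\<close>
  define r where "r = (\<lambda>i. if i = t then 0 else Suc i)"
  have "ren r q = lift q" if "q \<in> G" for q
    unfolding lift_def using assms(2) that by (intro ren_cong) (auto simp: r_def)
  moreover have "ren r (inst p t) = ren (\<lambda>i. i) p"
    unfolding inst_def ren_ren using assms(3) by (intro ren_cong) (auto simp: r_def split: nat.split)
  ultimately have "lift ` G \<turnstile> p"
    using deriv_ren[OF assms(1), of r] by (simp cong: image_cong)
  then show ?thesis by (rule deriv.allI)
qed

lemma deriv_cut: "insert p G \<turnstile> q \<Longrightarrow> G \<turnstile> p \<Longrightarrow> G \<turnstile> q"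
  by (meson deriv.impI deriv.impE)

lemma deriv_falsum: "G \<turnstile> Falsum \<Longrightarrow> G \<turnstile> p"
  by (meson deriv.raa deriv_mono subset_insertI)

text \<open>Leibniz's law for the pattern \<open>Eq 0 (Suc s)\<close>: index 0 is the slot, and
  \<open>inst\<close> lowers \<open>Suc s\<close> back to \<open>s\<close>.\<close>

lemma deriv_eq_sym: "G \<turnstile> Eq s t \<Longrightarrow> G \<turnstile> Eq t s"
  using deriv.eq_subst[of G s t "Eq 0 (Suc s)"] deriv.eq_refl by (simp add: inst_def)

lemma deriv_eq_trans: "G \<turnstile> Eq s t \<Longrightarrow> G \<turnstile> Eq t u \<Longrightarrow> G \<turnstile> Eq s u"
  using deriv.eq_subst[of G t u "Eq (Suc s) 0"] by (simp add: inst_def)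

lemma deriv_mem_cong:
  assumes "G \<turnstile> Eq s s'" "G \<turnstile> Eq t t'" "G \<turnstile> Mem s t"
  shows "G \<turnstile> Mem s' t'"
proof -
  have "G \<turnstile> Mem s' t"
    using deriv.eq_subst[OF assms(1), of "Mem 0 (Suc t)"] assms(3) by (simp add: inst_def)
  then show ?thesis
    using deriv.eq_subst[OF assms(2), of "Mem (Suc s') 0"] by (simp add: inst_def)
qed


section \<open>Completeness\<close>

instance fm :: countable by countable_datatype

text \<open>Equality has an interpretation \<open>I\<close> of its own, because in the term model it
  is provable equality between possibly distinct variables; it becomes true equality only in the
  quotient.\<close>

primrec sat :: "('a \<Rightarrow> 'a \<Rightarrow> bool) \<Rightarrow> ('a \<Rightarrow> 'a \<Rightarrow> bool) \<Rightarrow> (nat \<Rightarrow> 'a) \<Rightarrow> fm \<Rightarrow> bool" where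
  "sat I E e (Mem i j) = E (e i) (e j)"
| "sat I E e (Eq i j) = I (e i) (e j)"
| "sat I E e Falsum = False"
| "sat I E e (Imp p q) = (sat I E e p \<longrightarrow> sat I E e q)"
| "sat I E e (Forall p) = (\<forall>x. sat I E (case_nat x e) p)"

lemma sat_cong: "(\<And>i. i < free_bound p \<Longrightarrow> e i = e' i) \<Longrightarrow> sat I E e p = sat I E e' p"
proof (induction p arbitrary: e e')
  case (Forall p)
  have "sat I E (case_nat x e) p = sat I E (case_nat x e') p" for x
    using Forall.prems by (intro Forall.IH) (auto split: nat.split)
  then show ?case by simp
next
  case (Imp p q)
  have "sat I E e p = sat I E e' p" "sat I E e q = sat I E e' q"
    using Imp.prems by (auto intro!: Imp.IH)
  then show ?case by simp
qed auto

lemma sat_ren: "sat I E e (ren r p) = sat I E (\<lambda>i. e (r i)) p"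
proof (induction p arbitrary: e r)
  case (Forall p)
  have "(\<lambda>i. case_nat x e (case_nat 0 (\<lambda>i. Suc (r i)) i)) = case_nat x (\<lambda>i. e (r i))" for x
    by (auto split: nat.split)
  then show ?case by (simp add: Forall)
qed auto

abbreviation consistent :: "fm set \<Rightarrow> bool" where
  "consistent G \<equiv> \<not> (G \<turnstile> Falsum)"

text \<open>A common bound leaves a fresh index as Henkin witness at every stage; the bound itself
  may grow from stage to stage.\<close>

definition bounded :: "fm set \<Rightarrow> bool" where
  "bounded G = (\<exists>b. \<forall>p\<in>G. free_bound p \<le> b)"

lemma bounded_insert [simp]: "bounded (insert p G) = bounded G"
proof
  assume "bounded G"
  then obtain b where "\<forall>p\<in>G. free_bound p \<le> b" by (auto simp: bounded_def)
  then show "bounded (insert p G)"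
    unfolding bounded_def by (intro exI[of _ "max b (free_bound p)"]) auto
qed (auto simp: bounded_def)

lemma extend_decide:
  assumes "consistent G"
  shows "consistent (insert p G) \<or> consistent (insert (Imp p Falsum) G)"
  using assms by (meson deriv.raa deriv_cut)

text \<open>A bound \<open>b\<close> on the free indices is itself a witness: were the extension
  inconsistent, \<open>inst q b\<close> would be derivable, and generalizing over the fresh
  \<open>b\<close> would contradict the negated universal formula in \<open>G\<close>.\<close>

lemma extend_witness:
  assumes "consistent G" "bounded G" "Imp (Forall q) Falsum \<in> G"
  shows "\<exists>t. consistent (insert (Imp (inst q t) Falsum) G)"
proof -
  obtain b where b: "\<forall>p\<in>G. free_bound p \<le> b" using assms(2) by (auto simp: bounded_def)
  have "consistent (insert (Imp (inst q b) Falsum) G)"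
  proof
    assume "insert (Imp (inst q b) Falsum) G \<turnstile> Falsum"
    then have "G \<turnstile> inst q b" by (rule deriv.raa)
    moreover have "free_bound q \<le> Suc b" using b assms(3) by force
    ultimately have "G \<turnstile> Forall q" using b by (intro deriv_generalize)
    then show False using assms(1,3) by (meson deriv.assm deriv.impE)
  qed
  then show ?thesis ..
qed

lemma extend_step:
  assumes "consistent G" "bounded G"
  shows "\<exists>H. G \<subseteq> H \<and> consistent H \<and> bounded H \<and> (p \<in> H \<or> Imp p Falsum \<in> H) \<and>
    (\<forall>q. p = Imp (Forall q) Falsum \<and> p \<in> H \<longrightarrow> (\<exists>t. Imp (inst q t) Falsum \<in> H))"
proof (cases "consistent (insert p G)")
  case True
  show ?thesis
  proof (cases "\<exists>q. p = Imp (Forall q) Falsum")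
    case q: True
    then obtain q where q: "p = Imp (Forall q) Falsum" ..
    then obtain t where "consistent (insert (Imp (inst q t) Falsum) (insert p G))"
      using extend_witness[of "insert p G" q] True assms by auto
    then show ?thesis
      using q assms(2) by (intro exI[of _ "insert (Imp (inst q t) Falsum) (insert p G)"]) auto
  next
    case False
    then show ?thesis using True assms(2) by (intro exI[of _ "insert p G"]) auto
  qed
next
  case False
  then have "consistent (insert (Imp p Falsum) G)" using extend_decide assms by blast
  \<comment> \<open>With \<open>p\<close> kept out, the witness clause holds vacuously.\<close>
  moreover have "p \<notin> insert (Imp p Falsum) G"
    using calculation by (metis deriv.assm deriv.impE insertCI)
  ultimately show ?thesis
    using assms(2) by (intro exI[of _ "insert (Imp p Falsum) G"]) auto
qed

lemma henkin_extension:
  assumes "consistent G" "bounded G"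
  obtains U where "G \<subseteq> U" "consistent U" "\<And>p. p \<in> U \<or> Imp p Falsum \<in> U"
    "\<And>q. Imp (Forall q) Falsum \<in> U \<Longrightarrow> \<exists>t. Imp (inst q t) Falsum \<in> U"
proof -
  let ?step = "\<lambda>n G H. G \<subseteq> H \<and> (from_nat n \<in> H \<or> Imp (from_nat n) Falsum \<in> H) \<and>
    (\<forall>q. from_nat n = Imp (Forall q) Falsum \<and> from_nat n \<in> H \<longrightarrow> (\<exists>t. Imp (inst q t) Falsum \<in> H))"
  \<comment> \<open>The clause for \<open>n = 0\<close> makes the chain start at \<open>G\<close>.
    Stage \<open>n\<close> treats the formula coded by \<open>n\<close>, so every formula gets its
    turn.\<close>
  have "\<exists>H. \<forall>n. (consistent (H n) \<and> bounded (H n) \<and> (n = 0 \<longrightarrow> H n = G)) \<and> ?step n (H n) (H (Suc n))"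
  proof (rule dependent_nat_choice)
    show "\<exists>H. consistent H \<and> bounded H \<and> (0 = 0 \<longrightarrow> H = G)" using assms by blast
    fix H and n :: nat
    assume "consistent H \<and> bounded H \<and> (n = 0 \<longrightarrow> H = G)"
    then obtain H' where "consistent H'" "bounded H'" "?step n H H'"
      using extend_step[of H "from_nat n"] by auto
    then show "\<exists>H'. (consistent H' \<and> bounded H' \<and> (Suc n = 0 \<longrightarrow> H' = G)) \<and> ?step n H H'" by auto
  qed
  then obtain H where H0: "H 0 = G" and cons: "\<And>n. consistent (H n)"
    and step: "\<And>n. ?step n (H n) (H (Suc n))"
    by blast
  define U where "U = (\<Union>n. H n)"
  have mono: "H m \<subseteq> H n" if "m \<le> n" for m n
    by (rule lift_Suc_mono_le[OF _ that]) (use step in blast)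
  have consU: "consistent U"
  proof
    assume "U \<turnstile> Falsum"
    then obtain F where F: "finite F" "F \<subseteq> U" "F \<turnstile> Falsum" using deriv_finite by metis
    have "\<exists>n. F \<subseteq> H n"
      using F(1,2)
    proof (induction F)
      case (insert p F)
      then obtain m n where "F \<subseteq> H m" "p \<in> H n" by (auto simp: U_def)
      then have "insert p F \<subseteq> H (max m n)" using mono[of m "max m n"] mono[of n "max m n"] by auto
      then show ?case ..
    qed auto
    then show False using F(3) cons by (meson deriv_mono)
  qed
  have decide: "p \<in> U \<or> Imp p Falsum \<in> U" for p
  proof -
    have "p \<in> H (Suc (to_nat p)) \<or> Imp p Falsum \<in> H (Suc (to_nat p))"
      using step[of "to_nat p"] by simp
    then show ?thesis unfolding U_def by blast
  qed
  have "\<exists>t. Imp (inst q t) Falsum \<in> U" if "Imp (Forall q) Falsum \<in> U" for q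
  proof -
    let ?p = "Imp (Forall q) Falsum"
    \<comment> \<open>The stage that decides \<open>?p\<close> adds a witness only if it accepts
      \<open>?p\<close>. Its negation can never enter the consistent \<open>U\<close>, so
      \<open>?p\<close> was accepted at that stage.\<close>
    have "Imp ?p Falsum \<notin> U" using consU deriv.impE[of U ?p Falsum] deriv.assm[OF that] deriv.assm[of _ U] by blast
    then have "Imp ?p Falsum \<notin> H (Suc (to_nat ?p))" unfolding U_def by blast
    then have "\<exists>t. Imp (inst q t) Falsum \<in> H (Suc (to_nat ?p))" using step[of "to_nat ?p"] by simp
    then show ?thesis unfolding U_def by blast
  qed
  moreover have "G \<subseteq> U" unfolding U_def using H0 by blast
  ultimately show thesis using that[of U] consU decide by blast
qed

text \<open>The points of the term model are the variables, and an assignment is a renaming.\<close>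

lemma term_model:
  assumes "consistent G" "bounded G"
  obtains I E :: "nat \<Rightarrow> nat \<Rightarrow> bool" where
    "equivp I" "\<And>x x' y y'. I x x' \<Longrightarrow> I y y' \<Longrightarrow> E x y \<Longrightarrow> E x' y'" "\<forall>p\<in>G. sat I E (\<lambda>i. i) p"
proof -
  obtain U where U: "G \<subseteq> U" "consistent U" "\<And>p. p \<in> U \<or> Imp p Falsum \<in> U"
    "\<And>q. Imp (Forall q) Falsum \<in> U \<Longrightarrow> \<exists>t. Imp (inst q t) Falsum \<in> U"
    using henkin_extension[OF assms] by metis
  have closed: "p \<in> U \<longleftrightarrow> (U \<turnstile> p)" for p
    using U(2,3) by (meson deriv.assm deriv.impE)
  have neg: "Imp p Falsum \<in> U \<longleftrightarrow> p \<notin> U" for p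
    using U(2,3) by (meson deriv.assm deriv.impE)
  have imp: "Imp p q \<in> U \<longleftrightarrow> (p \<in> U \<longrightarrow> q \<in> U)" for p q
    using U(2,3) unfolding closed
    by (metis deriv.assm deriv.impE deriv.impI deriv_falsum deriv_mono insertI1 subset_insertI)
  have all: "Forall q \<in> U \<longleftrightarrow> (\<forall>t. inst q t \<in> U)" for q
    using U(4)[of q] deriv.allE[of U q] by (metis closed neg)
  define I where "I = (\<lambda>i j. Eq i j \<in> U)"
  define E where "E = (\<lambda>i j. Mem i j \<in> U)"
  \<comment> \<open>Stated for all \<open>r\<close>, because the quantifier case evaluates the body
    under \<open>case_nat t r\<close>; instantiating by the variables \<open>t\<close> covers all
    points of the model.\<close>
  have truth: "sat I E r p \<longleftrightarrow> ren r p \<in> U" for p r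
  proof (induction p arbitrary: r)
    case Falsum
    then show ?case using U(2) closed by simp
  next
    case (Forall p)
    have "inst (ren (case_nat 0 (\<lambda>i. Suc (r i))) p) t = ren (case_nat t r) p" for t
      by (auto simp: inst_def ren_ren intro!: ren_cong split: nat.split)
    then show ?case by (simp add: Forall all)
  qed (auto simp: I_def E_def imp)
  show thesis
  proof (rule that[of I E])
    show "equivp I"
      unfolding I_def closed
      by (intro equivpI reflpI sympI transpI) (auto intro: deriv.eq_refl deriv_eq_sym deriv_eq_trans)
    show "E x' y'" if "I x x'" "I y y'" "E x y" for x x' y y'
      using that deriv_mem_cong[of U x x' y y'] unfolding I_def E_def closed by blast
    show "\<forall>p\<in>G. sat I E (\<lambda>i. i) p"
      using U(1) by (auto simp: truth)
  qed
qed

text \<open>Surjectivity of \<open>q\<close> is what matches the quantifiers on the two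
  sides.\<close>

lemma sat_quotient:
  assumes q: "surj q" "\<And>x y. I x y \<longleftrightarrow> q x = q y" "\<And>x y. E x y \<longleftrightarrow> F (q x) (q y)"
  shows "sat I E e p \<longleftrightarrow> sat (=) F (\<lambda>i. q (e i)) p"
proof (induction p arbitrary: e)
  case (Forall p)
  have "(\<lambda>i. q (case_nat x e i)) = case_nat (q x) (\<lambda>i. q (e i))" for x
    by (auto split: nat.split)
  then show ?case using q(1) by (simp add: Forall) (metis surjD)
qed (auto simp: q)


section \<open>Models of ZF\<close>

lemma free_bound_Foralls: "free_bound ((Forall ^^ n) p) = free_bound p - n"
  by (induction n) auto

lemmas connective_defs = sentence_def f_mem_def f_eq_def f_imp_def f_not_def f_and_def
  f_or_def f_iff_def f_all_def f_ex_def f_ball_def f_bex_def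

lemma free_bound_ZF: "p \<in> ZF \<Longrightarrow> free_bound p = 0"
proof -
  assume "p \<in> ZF"
  then consider "p \<in> {extensionality, foundation, pairing, union, power_set, infinity}"
    | q where "p = closure q"
    by (auto simp: ZF_def separation_def replacement_def)
  then show ?thesis
  proof cases
    case 1
    then show ?thesis
      by (elim insertE emptyE)
        (simp_all add: connective_defs extensionality_def foundation_def pairing_def union_def
          power_set_def infinity_def)
  qed (simp add: closure_def free_bound_Foralls)
qed

lemma sat_Foralls: "\<forall>e. sat I E e ((Forall ^^ n) p) \<Longrightarrow> sat I E e p"
proof (induction n arbitrary: e)
  case (Suc n)
  have "sat I E (case_nat (e 0) (\<lambda>i. e (Suc i))) ((Forall ^^ n) p)" for e
    using Suc.prems by simp
  moreover have "case_nat (e 0) (\<lambda>i. e (Suc i)) = e" for e :: "nat \<Rightarrow> 'a"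
    by (auto split: nat.split)
  ultimately show ?case using Suc.IH by simp
qed auto

lemma sat_ZF:
  assumes "\<forall>p\<in>ZF. sat I E e p" "p \<in> ZF"
  shows "sat I E e' p"
  using assms sat_cong[of p e e'] by (auto simp: free_bound_ZF)

lemma sat_separation:
  assumes "\<forall>p\<in>ZF. sat I E e p"
  shows "\<exists>b. \<forall>x. E x b \<longleftrightarrow> E x a \<and> sat I E (case_nat x e') p"
proof -
  let ?F = "sentence (\<^bold>\<forall>a. \<^bold>\<exists>b. \<^bold>\<forall>x. x \<^bold>\<in> b \<^bold>\<longleftrightarrow> x \<^bold>\<in> a \<^bold>\<and> at1 p x)"
  have "separation p \<in> ZF" by (auto simp: ZF_def)
  then have "\<forall>e. sat I E e ((Forall ^^ free_bound ?F) ?F)"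
    using sat_ZF[OF assms] unfolding separation_def closure_def by blast
  then have F: "sat I E e' ?F" by (rule sat_Foralls)
  \<comment> \<open>Index 0 of \<open>p\<close> is the separated element; the parameters jump over
    the three quantifiers \<open>a\<close>, \<open>b\<close>, \<open>x\<close> and thus read
    \<open>e'\<close>.\<close>
  have env: "(\<lambda>i. case_nat x (case_nat b (case_nat a e')) (case_nat 0 (\<lambda>k. Suc (Suc (Suc 0)) + k) i))
      = case_nat x e'" for x a b
    by (auto split: nat.split)
  have "sat I E e' ?F \<longleftrightarrow>
      (\<forall>a. \<exists>b. \<forall>x. E x b \<longleftrightarrow> E x a \<and> sat I E (case_nat x e') p)"
    by (simp add: connective_defs at1_def sat_ren) (unfold env, blast)
  with F show ?thesis by blast
qed

lemma sat_pairing: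
  assumes "\<forall>p\<in>ZF. sat I E e p"
  shows "\<exists>u. \<forall>z. E z u \<longleftrightarrow> I z x \<or> I z y"
  using sat_ZF[OF assms, of pairing e] by (auto simp: ZF_def pairing_def connective_defs) metis

lemma sat_union:
  assumes "\<forall>p\<in>ZF. sat I E e p"
  shows "\<exists>u. \<forall>z. E z u \<longleftrightarrow> (\<exists>y. E y x \<and> E z y)"
  using sat_ZF[OF assms, of union e] by (auto simp: ZF_def union_def connective_defs) metis

lemma sat_power_set:
  assumes "\<forall>p\<in>ZF. sat I E e p"
  shows "\<exists>u. \<forall>z. E z u \<longleftrightarrow> (\<forall>w. E w z \<longrightarrow> E w x)"
  using sat_ZF[OF assms, of power_set e]
  by (simp add: ZF_def power_set_def connective_defs) metis

lemma sat_extensionality: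
  assumes "\<forall>p\<in>ZF. sat I E e p"
  shows "(\<And>z. E z x \<longleftrightarrow> E z y) \<Longrightarrow> I x y"
  using sat_ZF[OF assms, of extensionality e]
  by (simp add: ZF_def extensionality_def connective_defs)

text \<open>With finitely many points up to \<open>I\<close>, pairing and union would produce a universal set,
  which Russell's paradox forbids.\<close>

lemma ZF_model_infinite:
  assumes I: "equivp I" "\<And>x x' y y'. I x x' \<Longrightarrow> I y y' \<Longrightarrow> E x y \<Longrightarrow> E x' y'"
    and ZF: "\<forall>p\<in>ZF. sat I E e p"
    and D: "\<And>x. \<exists>y\<in>D. I x y"
  shows "infinite D"
proof
  assume "finite D"
  have "\<exists>u. \<forall>y\<in>F. E y u" if "finite F" for F
    using that
  proof induction
    case (insert x F)
    then obtain u where u: "\<forall>y\<in>F. E y u" by blast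
    \<comment> \<open>Adjoining one element: up to \<open>I\<close>, \<open>v\<close> is the
      singleton of \<open>x\<close>, and \<open>s\<close> below is the union of \<open>u\<close> and
      \<open>v\<close>.\<close>
    obtain v where v: "\<And>z. E z v \<longleftrightarrow> I z x \<or> I z x" using sat_pairing[OF ZF] by metis
    obtain w where w: "\<And>z. E z w \<longleftrightarrow> I z u \<or> I z v" using sat_pairing[OF ZF] by metis
    obtain s where s: "\<And>z. E z s \<longleftrightarrow> (\<exists>y. E y w \<and> E z y)" using sat_union[OF ZF] by metis
    have "\<forall>y\<in>insert x F. E y s" unfolding s w using u v equivp_reflp[OF I(1)] by blast
    then show ?case ..
  qed auto
  then obtain u where "\<forall>y\<in>D. E y u" using \<open>finite D\<close> by blast
  then have univ: "E x u" for x
    using D[of x] I(2) equivp_symp[OF I(1)] equivp_reflp[OF I(1)] by metis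
  \<comment> \<open>The formula says that a point is not a member of itself: Russell's set, cut out
    of the universal \<open>u\<close>.\<close>
  obtain b where "\<forall>x. E x b \<longleftrightarrow> E x u \<and> sat I E (case_nat x e) (Imp (Mem 0 0) Falsum)"
    using sat_separation[OF ZF] by metis
  then show False using univ by auto
qed

text \<open>Models on \<open>nat\<close> with true equality suffice: the variables modulo
  \<open>I\<close> are countable, and infinite by \<open>ZF_model_infinite\<close>, so the classes
  can be renumbered by \<open>nat\<close>.\<close>

lemma ZF_complete:
  fixes p :: fm
  assumes "\<And>(E :: nat \<Rightarrow> nat \<Rightarrow> bool) e. \<forall>q\<in>ZF. sat (=) E e q \<Longrightarrow> sat (=) E e p"
  shows "ZF \<turnstile> p"
proof (rule ccontr)
  assume "\<not> (ZF \<turnstile> p)"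
  then have cons: "consistent (insert (Imp p Falsum) ZF)" using deriv.raa by blast
  have bdd: "bounded (insert (Imp p Falsum) ZF)"
    by simp (auto simp: bounded_def free_bound_ZF)
  obtain I E :: "nat \<Rightarrow> nat \<Rightarrow> bool" where
    I: "equivp I" "\<And>x x' y y'. I x x' \<Longrightarrow> I y y' \<Longrightarrow> E x y \<Longrightarrow> E x' y'"
    and sat: "\<forall>q\<in>insert (Imp p Falsum) ZF. sat I E (\<lambda>i. i) q"
    by (rule term_model[OF cons bdd]) blast
  define rep where "rep = (\<lambda>x. LEAST y. I x y)"
  have rep: "I x (rep x)" for x
    unfolding rep_def using equivp_reflp[OF I(1)] by (rule LeastI)
  have rep_eq: "I x y \<longleftrightarrow> rep x = rep y" for x y
  proof
    assume "I x y"
    then have "I x = I y" using I(1) by (simp add: equivp_def)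
    then show "rep x = rep y" by (simp add: rep_def)
  qed (use rep equivp_symp[OF I(1)] equivp_transp[OF I(1)] in metis)
  have "infinite (range rep)"
  proof (rule ZF_model_infinite[of I E "\<lambda>i. i"])
    show "\<forall>q\<in>ZF. sat I E (\<lambda>i. i) q" using sat by blast
    show "\<exists>y\<in>range rep. I x y" for x using rep by blast
  qed (use I in blast)+
  then obtain h :: "nat \<Rightarrow> nat" where h: "bij_betw h (range rep) UNIV"
    using to_nat_on_infinite[of "range rep"] by blast
  define q where "q = (\<lambda>x. h (rep x))"
  \<comment> \<open>This does not depend on the representatives, since \<open>E\<close> respects
    \<open>I\<close>.\<close>
  define F where "F = (\<lambda>a b. \<exists>x y. q x = a \<and> q y = b \<and> E x y)"
  have "surj q" using h by (auto simp: q_def bij_betw_def image_image)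
  moreover have q: "I x y \<longleftrightarrow> q x = q y" for x y
    using h by (auto simp: q_def rep_eq bij_betw_def inj_on_def)
  moreover have "E x y \<longleftrightarrow> F (q x) (q y)" for x y
    unfolding F_def q[symmetric] using I equivp_reflp[OF I(1)] by blast
  ultimately have quot: "sat I E e r \<longleftrightarrow> sat (=) F (\<lambda>i. q (e i)) r" for e r
    by (rule sat_quotient)
  have "\<forall>r\<in>ZF. sat (=) F q r" using sat quot[of "\<lambda>i. i"] by blast
  then have "sat I E (\<lambda>i. i) p" using assms quot[of "\<lambda>i. i"] by blast
  then show False using sat by simp
qed

section \<open>Definable predicates in a model\<close>

text \<open>Separation stays a scheme over \<open>fm\<close> with parameters in \<open>e\<close>.
  Arbitrary HOL predicates cannot be used to separate, which is what keeps the choice of the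
  metalogic out of the model.\<close>

locale zf_model =
  fixes mem :: "'a \<Rightarrow> 'a \<Rightarrow> bool" (infix "\<epsilon>" 50) and outer :: "nat \<Rightarrow> 'a"
  assumes extensional: "(\<And>z. z \<epsilon> x \<longleftrightarrow> z \<epsilon> y) \<Longrightarrow> x = y"
    and pairing: "\<exists>u. \<forall>z. z \<epsilon> u \<longleftrightarrow> z = x \<or> z = y"
    and union: "\<exists>u. \<forall>z. z \<epsilon> u \<longleftrightarrow> (\<exists>y. y \<epsilon> x \<and> z \<epsilon> y)"
    and power_set: "\<exists>u. \<forall>z. z \<epsilon> u \<longleftrightarrow> (\<forall>w. w \<epsilon> z \<longrightarrow> w \<epsilon> x)"
    and sat_separation: "\<exists>b. \<forall>x. x \<epsilon> b \<longleftrightarrow> x \<epsilon> a \<and> sat (=) (\<epsilon>) (case_nat x e) p"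
begin

text \<open>Every variable of the defining formula is sent either to an argument or to a parameter.\<close>

definition definable :: "((nat \<Rightarrow> 'a) \<Rightarrow> bool) \<Rightarrow> bool" where
  "definable P = (\<exists>p r. \<forall>e. P e = sat (=) (\<epsilon>) (\<lambda>i. case_sum e id (r i)) p)"

lemma definable_ren:
  assumes "definable P"
  shows "definable (\<lambda>e. P (\<lambda>i. e (f i)))"
proof -
  obtain p r where p: "\<And>e. P e = sat (=) (\<epsilon>) (\<lambda>i. case_sum e id (r i)) p"
    using assms by (auto simp: definable_def)
  have "case_sum e id (map_sum f id x) = case_sum (\<lambda>i. e (f i)) id x" for e and x :: "nat + 'a"
    by (cases x) auto
  then show ?thesis
    unfolding definable_def p by (intro exI[of _ p] exI[of _ "\<lambda>i. map_sum f id (r i)"]) simp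
qed

lemma definable_imp:
  assumes "definable P" "definable Q"
  shows "definable (\<lambda>e. P e \<longrightarrow> Q e)"
proof -
  obtain p r where p: "\<And>e. P e = sat (=) (\<epsilon>) (\<lambda>i. case_sum e id (r i)) p"
    using assms(1) by (auto simp: definable_def)
  obtain q s where q: "\<And>e. Q e = sat (=) (\<epsilon>) (\<lambda>i. case_sum e id (s i)) q"
    using assms(2) by (auto simp: definable_def)
  \<comment> \<open>Even indices serve \<open>p\<close> and odd ones \<open>q\<close>, so that the
    two assignments of variables do not collide.\<close>
  show ?thesis
    unfolding definable_def p q
    by (intro exI[of _ "Imp (ren (\<lambda>i. 2 * i) p) (ren (\<lambda>i. Suc (2 * i)) q)"]
        exI[of _ "\<lambda>i. if even i then r (i div 2) else s (i div 2)"]) (simp add: sat_ren)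
qed

lemma definable_False: "definable (\<lambda>e. False)"
  unfolding definable_def by (intro exI[of _ Falsum]) simp

lemma definable_all:
  assumes "definable (\<lambda>e. P (e 0) (\<lambda>i. e (Suc i)))"
  shows "definable (\<lambda>e. \<forall>x. P x e)"
proof -
  obtain p r where p: "\<And>e. P (e 0) (\<lambda>i. e (Suc i)) = sat (=) (\<epsilon>) (\<lambda>i. case_sum e id (r i)) p"
    using assms by (auto simp: definable_def)
  have P: "P x e = sat (=) (\<epsilon>) (\<lambda>i. case_sum (case_nat x e) id (r i)) p" for x e
    using p[of "case_nat x e"] by simp
  \<comment> \<open>Indices that \<open>r\<close> sends to \<open>Inl 0\<close> become the bound
    index 0, so the value of \<open>s\<close> there is never read; all other arguments move down by
    one.\<close>
  define s where "s = (\<lambda>i. case r i of Inl j \<Rightarrow> Inl (j - 1) | Inr c \<Rightarrow> Inr c)"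
  have "case_sum (case_nat x e) id (r i) =
      case_nat x (\<lambda>i. case_sum e id (s i)) (if r i = Inl 0 then 0 else Suc i)" for x e i
    by (auto simp: s_def split: sum.split nat.split)
  then show ?thesis
    unfolding definable_def P
    by (intro exI[of _ "Forall (ren (\<lambda>i. if r i = Inl 0 then 0 else Suc i) p)"] exI[of _ s])
      (simp add: sat_ren)
qed

lemma definable_not: "definable P \<Longrightarrow> definable (\<lambda>e. \<not> P e)"
  using definable_imp[OF _ definable_False] by simp

lemma definable_disj: "definable P \<Longrightarrow> definable Q \<Longrightarrow> definable (\<lambda>e. P e \<or> Q e)"
  using definable_imp[of "\<lambda>e. \<not> P e" Q] definable_not by (auto simp: imp_conv_disj)

lemma definable_conj: "definable P \<Longrightarrow> definable Q \<Longrightarrow> definable (\<lambda>e. P e \<and> Q e)"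
  using definable_not[OF definable_imp[of P "\<lambda>e. \<not> Q e"]] definable_not[of Q] by simp

lemma definable_iff: "definable P \<Longrightarrow> definable Q \<Longrightarrow> definable (\<lambda>e. P e \<longleftrightarrow> Q e)"
  unfolding iff_conv_conj_imp by (intro definable_conj definable_imp)

lemma definable_ex:
  assumes "definable (\<lambda>e. P (e 0) (\<lambda>i. e (Suc i)))"
  shows "definable (\<lambda>e. \<exists>x. P x e)"
  using definable_not[OF definable_all[of "\<lambda>x e. \<not> P x e"]] definable_not[OF assms] by simp

definition definable_term :: "((nat \<Rightarrow> 'a) \<Rightarrow> 'a) \<Rightarrow> bool" where
  "definable_term t = definable (\<lambda>e. e 0 = t (\<lambda>i. e (Suc i)))"

lemma definable_term_var: "definable_term (\<lambda>e. e i)"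
  unfolding definable_term_def definable_def
  by (intro exI[of _ "Eq 0 1"] exI[of _ "\<lambda>n. Inl (if n = 0 then 0 else Suc i)"]) simp

lemma definable_term_const: "definable_term (\<lambda>e. c)"
  unfolding definable_term_def definable_def
  by (intro exI[of _ "Eq 0 1"] exI[of _ "\<lambda>n. if n = 0 then Inl 0 else Inr c"]) simp

text \<open>With no function symbols in the object language, a term is substituted by quantifying
  over its value.\<close>

lemma definable_subst:
  assumes "definable_term t" "definable (\<lambda>e. P (e 0) (\<lambda>i. e (Suc i)))"
  shows "definable (\<lambda>e. P (t e) e)"
proof -
  have "definable (\<lambda>e. \<exists>x. x = t e \<and> P x e)"
    using assms by (intro definable_ex definable_conj) (auto simp: definable_term_def)
  then show ?thesis by simp
qed

lemma definable_term_shift: "definable_term t \<Longrightarrow> definable_term (\<lambda>e. t (\<lambda>i. e (f i)))"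
  unfolding definable_term_def
  using definable_ren[of "\<lambda>e. e 0 = t (\<lambda>i. e (Suc i))" "case_nat 0 (\<lambda>i. Suc (f i))"] by simp

lemma definable_mem:
  assumes "definable_term s" "definable_term t"
  shows "definable (\<lambda>e. s e \<epsilon> t e)"
proof (rule definable_subst[OF assms(1)])
  have "definable (\<lambda>e. e (Suc 0) \<epsilon> e 0)"
    unfolding definable_def
    by (intro exI[of _ "Mem 1 0"] exI[of _ Inl]) simp
  then show "definable (\<lambda>e. e 0 \<epsilon> t (\<lambda>i. e (Suc i)))"
    using definable_subst[OF definable_term_shift[OF assms(2)], of "\<lambda>y e. e 0 \<epsilon> y"] by simp
qed

lemma definable_eq:
  assumes "definable_term s" "definable_term t"
  shows "definable (\<lambda>e. s e = t e)"
  using definable_subst[OF assms(1), of "\<lambda>x e. x = t e"] assms(2) by (simp add: definable_term_def)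

section \<open>Pairs, products and functions as points of the model\<close>

definition pair :: "'a \<Rightarrow> 'a \<Rightarrow> 'a" where
  "pair x y = (THE u. \<forall>z. z \<epsilon> u \<longleftrightarrow> z = x \<or> z = y)"

lemma mem_pair [simp]: "z \<epsilon> pair x y \<longleftrightarrow> z = x \<or> z = y"
proof -
  have "\<exists>!u. \<forall>z. z \<epsilon> u \<longleftrightarrow> z = x \<or> z = y"
    using pairing[of x y] by (metis extensional)
  from theI'[OF this] show ?thesis by (simp add: pair_def)
qed

lemma eq_pair_iff: "v = pair x y \<longleftrightarrow> (\<forall>z. z \<epsilon> v \<longleftrightarrow> z = x \<or> z = y)"
  using extensional[of v "pair x y"] by auto

text \<open>Kuratowski's ordered pair, the value of \<open>opair\<close> on single-valued
  terms.\<close>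

abbreviation kpair :: "'a \<Rightarrow> 'a \<Rightarrow> 'a" where
  "kpair x y \<equiv> pair (pair x x) (pair x y)"

lemma pair_inject: "pair x y = pair x' y' \<longleftrightarrow> x = x' \<and> y = y' \<or> x = y' \<and> y = x'"
proof -
  have "pair x y = pair x' y' \<longleftrightarrow> (\<forall>z. z = x \<or> z = y \<longleftrightarrow> z = x' \<or> z = y')"
    by (simp add: eq_pair_iff)
  then show ?thesis by metis
qed

lemma kpair_inject [simp]: "kpair x y = kpair x' y' \<longleftrightarrow> x = x' \<and> y = y'"
  by (auto simp: pair_inject)

lemma definable_term_pair:
  assumes "definable_term s" "definable_term t"
  shows "definable_term (\<lambda>e. pair (s e) (t e))"
  unfolding definable_term_def eq_pair_iff
  by (intro definable_all definable_iff definable_mem definable_disj definable_eq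
      definable_term_var definable_term_shift[OF assms(1)] definable_term_shift[OF assms(2)])

lemmas definable_intros = definable_all definable_ex definable_conj definable_disj definable_imp
  definable_not definable_iff definable_mem definable_eq definable_term_pair definable_term_var
  definable_term_const

lemma separation:
  assumes "definable (\<lambda>e. P (e 0))"
  shows "\<exists>b. \<forall>x. x \<epsilon> b \<longleftrightarrow> x \<epsilon> a \<and> P x"
proof -
  obtain p r where p: "\<And>e :: nat \<Rightarrow> 'a. P (e 0) = sat (=) (\<epsilon>) (\<lambda>i. case_sum e id (r i)) p"
    using assms by (auto simp: definable_def)
  \<comment> \<open>\<open>P (e 0)\<close> looks at \<open>e 0\<close> only, so \<open>e\<close> may
    be taken constantly \<open>x\<close>: every argument variable collapses to index 0, while each
    parameter keeps its own slot \<open>Suc i\<close> and its value in \<open>c\<close>.\<close>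
  define s where "s = (\<lambda>i. case r i of Inl _ \<Rightarrow> 0 | Inr _ \<Rightarrow> Suc i)"
  define c where "c = (\<lambda>i. case r i of Inl _ \<Rightarrow> a | Inr c \<Rightarrow> c)"
  have "(\<lambda>i. case_nat x c (s i)) = (\<lambda>i. case_sum (\<lambda>_. x) id (r i))" for x
    by (auto simp: s_def c_def split: sum.split)
  then have "P x = sat (=) (\<epsilon>) (case_nat x c) (ren s p)" for x
    using p[of "\<lambda>_. x"] by (simp add: sat_ren)
  then show ?thesis using sat_separation[of a c "ren s p"] by simp
qed

definition cprod :: "'a \<Rightarrow> 'a \<Rightarrow> 'a" where
  "cprod A B = (THE u. \<forall>p. p \<epsilon> u \<longleftrightarrow> (\<exists>a b. a \<epsilon> A \<and> b \<epsilon> B \<and> p = kpair a b))"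

text \<open>Ordered pairs over \<open>A\<close> and \<open>B\<close> lie in the double power set of
  the union of \<open>A\<close> and \<open>B\<close>, from which separation cuts out the
  product.\<close>

lemma mem_cprod: "p \<epsilon> cprod A B \<longleftrightarrow> (\<exists>a b. a \<epsilon> A \<and> b \<epsilon> B \<and> p = kpair a b)"
proof -
  obtain U where U: "\<And>z. z \<epsilon> U \<longleftrightarrow> z \<epsilon> A \<or> z \<epsilon> B"
    using union[of "pair A B"] by auto
  obtain P where P: "\<And>z. z \<epsilon> P \<longleftrightarrow> (\<forall>w. w \<epsilon> z \<longrightarrow> w \<epsilon> U)"
    using power_set[of U] by auto
  obtain PP where PP: "\<And>z. z \<epsilon> PP \<longleftrightarrow> (\<forall>w. w \<epsilon> z \<longrightarrow> w \<epsilon> P)"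
    using power_set[of P] by auto
  let ?P = "\<lambda>p. \<exists>a b. a \<epsilon> A \<and> b \<epsilon> B \<and> p = kpair a b"
  have def_P: "definable (\<lambda>e. ?P (e 0))"
    by (rule definable_intros)+
  have "kpair a b \<epsilon> PP" if "a \<epsilon> A" "b \<epsilon> B" for a b
    using that by (auto simp: PP P U)
  moreover obtain u where "\<And>p. p \<epsilon> u \<longleftrightarrow> p \<epsilon> PP \<and> ?P p"
    using separation[OF def_P, of PP] by blast
  ultimately have u: "\<forall>p. p \<epsilon> u \<longleftrightarrow> ?P p"
    by blast
  have "\<exists>!u. \<forall>p. p \<epsilon> u \<longleftrightarrow> ?P p"
  proof (rule ex1I[of _ u])
    fix v
    assume "\<forall>p. p \<epsilon> v \<longleftrightarrow> ?P p"
    then show "v = u" using u by (intro extensional) simp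
  qed (rule u)
  from theI'[OF this] show ?thesis unfolding cprod_def by blast
qed

lemma kpair_mem_cprod [simp]: "kpair a b \<epsilon> cprod A B \<longleftrightarrow> a \<epsilon> A \<and> b \<epsilon> B"
  by (auto simp: mem_cprod)

lemma eq_cprod_iff: "v = cprod A B \<longleftrightarrow> (\<forall>p. p \<epsilon> v \<longleftrightarrow> (\<exists>a b. a \<epsilon> A \<and> b \<epsilon> B \<and> p = kpair a b))"
  using extensional[of v "cprod A B"] by (auto simp: mem_cprod)

text \<open>Shaped like the unfolding of \<open>maps\<close>, so that evaluating that formula is
  plain simplification.\<close>

definition is_fun :: "'a \<Rightarrow> 'a \<Rightarrow> 'a \<Rightarrow> bool" where
  "is_fun f A B \<longleftrightarrow> (\<forall>p. p \<epsilon> f \<longrightarrow> (\<exists>x. x \<epsilon> A \<and> (\<exists>y. y \<epsilon> B \<and> p = kpair x y))) \<and>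
    (\<forall>x. x \<epsilon> A \<longrightarrow> (\<exists>y. \<forall>z. kpair x z \<epsilon> f \<longleftrightarrow> z = y))"

definition fapp :: "'a \<Rightarrow> 'a \<Rightarrow> 'a" where
  "fapp f x = (THE y. kpair x y \<epsilon> f)"

text \<open>The rewrite rule that turns the relational reading of terms in the statement into
  equations between values of \<open>fapp\<close>.\<close>

lemma is_fun_graph:
  assumes "is_fun f A B"
  shows "kpair x y \<epsilon> f \<longleftrightarrow> x \<epsilon> A \<and> y = fapp f x"
proof -
  have A: "x \<epsilon> A" if "kpair x y \<epsilon> f" for y
    using assms that by (auto simp: is_fun_def)
  show ?thesis
  proof (cases "x \<epsilon> A")
    case True
    then obtain z where "\<And>y. kpair x y \<epsilon> f \<longleftrightarrow> y = z" using assms by (auto simp: is_fun_def)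
    then show ?thesis using True by (simp add: fapp_def)
  qed (use A in blast)
qed

lemma is_fun_fapp:
  assumes "is_fun f A B" "x \<epsilon> A"
  shows "fapp f x \<epsilon> B"
proof -
  have "kpair x (fapp f x) \<epsilon> f" using is_fun_graph assms by blast
  then show ?thesis using assms(1) by (auto simp: is_fun_def)
qed

lemma is_funI:
  assumes "\<And>p. p \<epsilon> f \<longleftrightarrow> (\<exists>x. x \<epsilon> A \<and> p = kpair x (F x))" "\<And>x. x \<epsilon> A \<Longrightarrow> F x \<epsilon> B"
  shows "is_fun f A B" "\<And>x. x \<epsilon> A \<Longrightarrow> fapp f x = F x"
proof -
  show f: "is_fun f A B" unfolding is_fun_def using assms by auto
  show "fapp f x = F x" if "x \<epsilon> A" for x
    using is_fun_graph[OF f, of x "F x"] that assms(1) by auto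
qed


section \<open>Evaluation of formulas with named variables\<close>

text \<open>\<open>e\<close> is indexed by levels and \<open>sat\<close> by de Bruijn indices, hence
  the reversal \<open>d - Suc i\<close>; \<open>outer\<close> takes over beyond the \<open>d\<close>
  quantifiers.\<close>

definition holds :: "nat \<Rightarrow> (nat \<Rightarrow> 'a) \<Rightarrow> form \<Rightarrow> bool" where
  "holds d e F = sat (=) (\<epsilon>) (\<lambda>i. if i < d then e (d - Suc i) else outer (i - d)) (F d)"

lemma holds_sentence: "holds 0 e F = sat (=) (\<epsilon>) outer (sentence F)"
  by (simp add: holds_def sentence_def)

lemma holds_mem [simp]: "x < d \<Longrightarrow> y < d \<Longrightarrow> holds d e (x \<^bold>\<in> y) \<longleftrightarrow> e x \<epsilon> e y"
  by (simp add: holds_def f_mem_def)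

lemma holds_eq [simp]: "x < d \<Longrightarrow> y < d \<Longrightarrow> holds d e (x \<^bold>= y) \<longleftrightarrow> e x = e y"
  by (simp add: holds_def f_eq_def)

lemma holds_imp [simp]: "holds d e (F \<^bold>\<longrightarrow> G) \<longleftrightarrow> (holds d e F \<longrightarrow> holds d e G)"
  by (simp add: holds_def f_imp_def)

lemma holds_not [simp]: "holds d e (\<^bold>\<not> F) \<longleftrightarrow> \<not> holds d e F"
  by (simp add: holds_def f_not_def)

lemma holds_and [simp]: "holds d e (F \<^bold>\<and> G) \<longleftrightarrow> holds d e F \<and> holds d e G"
  by (simp add: f_and_def)

lemma holds_or [simp]: "holds d e (F \<^bold>\<or> G) \<longleftrightarrow> holds d e F \<or> holds d e G"
  by (auto simp add: f_or_def)

lemma holds_iff [simp]: "holds d e (F \<^bold>\<longleftrightarrow> G) \<longleftrightarrow> (holds d e F \<longleftrightarrow> holds d e G)"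
  by (auto simp add: f_iff_def)

lemma holds_all [simp]: "holds d e (f_all F) \<longleftrightarrow> (\<forall>a. holds (Suc d) (e(d := a)) (F d))"
proof -
  have "case_nat a (\<lambda>i. if i < d then e (d - Suc i) else outer (i - d)) =
      (\<lambda>i. if i < Suc d then (e(d := a)) (Suc d - Suc i) else outer (i - Suc d))" for a
    by (auto simp: fun_eq_iff split: nat.split)
  then show ?thesis by (simp add: holds_def f_all_def)
qed

lemma holds_ex [simp]: "holds d e (f_ex F) \<longleftrightarrow> (\<exists>a. holds (Suc d) (e(d := a)) (F d))"
  by (simp add: f_ex_def)

lemma holds_ball [simp]: "A < d \<Longrightarrow>
    holds d e (f_ball A F) \<longleftrightarrow> (\<forall>a. a \<epsilon> e A \<longrightarrow> holds (Suc d) (e(d := a)) (F d))"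
  by (simp add: f_ball_def)

lemma holds_bex [simp]: "A < d \<Longrightarrow>
    holds d e (f_bex A F) \<longleftrightarrow> (\<exists>a. a \<epsilon> e A \<and> holds (Suc d) (e(d := a)) (F d))"
  by (simp add: f_bex_def)

text \<open>\<open>wf_trm d t\<close> says that \<open>t\<close> uses only variables below \<open>d\<close>; then its set \<open>den d e t\<close> of
  values does not depend on the depth at which \<open>t\<close> is used.\<close>

definition den :: "nat \<Rightarrow> (nat \<Rightarrow> 'a) \<Rightarrow> trm \<Rightarrow> 'a \<Rightarrow> bool" where
  "den d e t a = holds (Suc d) (e(d := a)) (t d)"

definition wf_trm :: "nat \<Rightarrow> trm \<Rightarrow> bool" where
  "wf_trm d t \<longleftrightarrow> (\<forall>e d' e' v. d \<le> d' \<longrightarrow> (\<forall>i<d. e' i = e i) \<longrightarrow> v < d' \<longrightarrow>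
    holds d' e' (t v) = den d e t (e' v))"

lemma holds_trm:
  "wf_trm d t \<Longrightarrow> d \<le> d' \<Longrightarrow> \<forall>i<d. e' i = e i \<Longrightarrow> v < d' \<Longrightarrow>
    holds d' e' (t v) = den d e t (e' v)"
  by (simp add: wf_trm_def)

lemma holds_trm_same [simp]: "wf_trm d t \<Longrightarrow> v < d \<Longrightarrow> holds d e (t v) = den d e t (e v)"
  by (rule holds_trm) auto

text \<open>One computation, uniform over all deeper environments, gives both well-formedness and
  the value; most of the term formers below are treated by it.\<close>

lemma wf_trmI:
  assumes "\<And>e d' e' v. d \<le> d' \<Longrightarrow> \<forall>i<d. e' i = e i \<Longrightarrow> v < d' \<Longrightarrow> holds d' e' (t v) = T e (e' v)"
  shows "wf_trm d t" "den d e t = T e"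
proof -
  show *: "den d e t = T e" for e
    using assms[of "Suc d" _ e d] by (simp add: fun_eq_iff den_def)
  show "wf_trm d t" unfolding wf_trm_def * using assms by blast
qed

lemma den_mono:
  assumes "wf_trm d t" "d \<le> d'" "\<forall>i<d. e' i = e i"
  shows "den d' e' t = den d e t"
  using assms holds_trm[OF assms(1), of "Suc d'" _ e d'] by (simp add: fun_eq_iff den_def)

lemma wf_trm_mono:
  assumes "wf_trm d t" "d \<le> d'"
  shows "wf_trm d' t"
  unfolding wf_trm_def
proof (intro HOL.allI HOL.impI)
  fix e e' :: "nat \<Rightarrow> 'a" and d'' v
  assume *: "d' \<le> d''" "\<forall>i<d'. e' i = e i" "v < d''"
  then have "holds d'' e' (t v) = den d e t (e' v)"
    using assms by (intro holds_trm) auto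
  then show "holds d'' e' (t v) = den d' e t (e' v)"
    using den_mono[OF assms, of e e] by simp
qed

lemma
  assumes "x < d"
  shows wf_V [simp]: "wf_trm d (V x)" and den_V [simp]: "den d e (V x) = (\<lambda>v. v = e x)"
  using wf_trmI[of d "V x" "\<lambda>e v. v = e x"] assms by (auto simp: V_def)

lemma
  assumes "wf_trm d s" "wf_trm d t"
  shows wf_upair [simp]: "wf_trm d (upair s t)"
    and den_upair [simp]: "den d e (upair s t) =
      (\<lambda>v. \<exists>x y. den d e s x \<and> den d e t y \<and> v = pair x y)"
proof -
  have *: "holds d' e' (upair s t v) \<longleftrightarrow>
      (\<exists>x y. den d e s x \<and> den d e t y \<and> e' v = pair x y)"
    if "d \<le> d'" "\<forall>i<d. e' i = e i" "v < d'" for e d' e' v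
    using that by (simp add: upair_def eq_pair_iff holds_trm[OF assms(1), of _ _ e]
        holds_trm[OF assms(2), of _ _ e])
  let ?T = "\<lambda>e v. \<exists>x y. den d e s x \<and> den d e t y \<and> v = pair x y"
  show "wf_trm d (upair s t)" by (rule wf_trmI(1)[where T = ?T]) (rule *)
  show "den d e (upair s t) =
      (\<lambda>v. \<exists>x y. den d e s x \<and> den d e t y \<and> v = pair x y)" by (rule wf_trmI(2)[where T = ?T]) (rule *)
qed

text \<open>\<open>s\<close> occurs three times in the Kuratowski pair, and a term is a mere
  relation that might have several values, so each occurrence may take its own.\<close>

lemma
  assumes "wf_trm d s" "wf_trm d t"
  shows wf_opair [simp]: "wf_trm d (opair s t)"
    and den_opair [simp]: "den d e (opair s t) =
      (\<lambda>v. \<exists>x x' x'' y. den d e s x \<and> den d e s x' \<and> den d e s x'' \<and> den d e t y \<and>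
        v = pair (pair x x') (pair x'' y))"
  using assms by (auto simp: opair_def fun_eq_iff)

lemma holds_related [simp]:
  assumes "r < d" "wf_trm d s" "wf_trm d t"
  shows "holds d e (related r s t) \<longleftrightarrow>
    (\<exists>x x' x'' y. den d e s x \<and> den d e s x' \<and> den d e s x'' \<and> den d e t y \<and>
        pair (pair x x') (pair x'' y) \<epsilon> e r)"
  using assms unfolding related_def
  by (simp add: holds_trm[OF wf_opair[OF assms(2,3)], of _ _ e]) blast

lemma
  assumes "f < d" "wf_trm d s"
  shows wf_app [simp]: "wf_trm d (app f s)"
    and den_app [simp]: "den d e (app f s) =
      (\<lambda>v. \<exists>x x' x''. den d e s x \<and> den d e s x' \<and> den d e s x'' \<and>
        pair (pair x x') (pair x'' v) \<epsilon> e f)"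
proof -
  have *: "holds d' e' (app f s v) \<longleftrightarrow>
      (\<exists>x x' x''. den d e s x \<and> den d e s x' \<and> den d e s x'' \<and>
        pair (pair x x') (pair x'' (e' v)) \<epsilon> e f)"
    if "d \<le> d'" "\<forall>i<d. e' i = e i" "v < d'" for e d' e' v
    using that assms(1) wf_trm_mono[OF assms(2) that(1)] den_mono[OF assms(2) that(1,2)]
    by (simp add: app_def)
  let ?T = "\<lambda>e v. \<exists>x x' x''. den d e s x \<and> den d e s x' \<and> den d e s x'' \<and>
        pair (pair x x') (pair x'' v) \<epsilon> e f"
  show "wf_trm d (app f s)" by (rule wf_trmI(1)[where T = ?T]) (rule *)
  show "den d e (app f s) =
      (\<lambda>v. \<exists>x x' x''. den d e s x \<and> den d e s x' \<and> den d e s x'' \<and>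
        pair (pair x x') (pair x'' v) \<epsilon> e f)" by (rule wf_trmI(2)[where T = ?T]) (rule *)
qed

lemma holds_t_eq [simp]:
  assumes "wf_trm d s" "wf_trm d t"
  shows "holds d e (s \<^bold>\<simeq> t) \<longleftrightarrow> (\<exists>v. den d e s v \<and> den d e t v)"
  unfolding t_eq_def by (simp add: holds_trm[OF assms(1), of _ _ e] holds_trm[OF assms(2), of _ _ e])

lemma holds_cartesian [simp]:
  "A < d \<Longrightarrow> B < d \<Longrightarrow> v < d \<Longrightarrow> holds d e (cartesian A B v) \<longleftrightarrow> e v = cprod (e A) (e B)"
  by (simp add: cartesian_def eq_cprod_iff)

lemma holds_maps [simp]:
  "f < d \<Longrightarrow> A < d \<Longrightarrow> B < d \<Longrightarrow> holds d e (maps f A B) \<longleftrightarrow> is_fun (e f) (e A) (e B)"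
  by (simp add: maps_def is_fun_def)

lemma holds_maps2 [simp]:
  "f < d \<Longrightarrow> A < d \<Longrightarrow> B < d \<Longrightarrow> C < d \<Longrightarrow>
    holds d e (maps2 f A B C) \<longleftrightarrow> is_fun (e f) (cprod (e A) (e B)) (e C)"
  by (simp add: maps2_def)

lemma holds_image_of [simp]:
  "f < d \<Longrightarrow> A < d \<Longrightarrow> J < d \<Longrightarrow> holds d e (image_of f A J) \<longleftrightarrow>
    (\<forall>y. y \<epsilon> e J \<longleftrightarrow> (\<exists>x. x \<epsilon> e A \<and> kpair x y \<epsilon> e f))"
  by (simp add: image_of_def)


text \<open>At most one value: then the separate occurrences inside a pair must agree, and
  \<open>kpair\<close> reappears.\<close>

definition single :: "('a \<Rightarrow> bool) \<Rightarrow> bool" where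
  "single S \<longleftrightarrow> (\<forall>x y. S x \<longrightarrow> S y \<longrightarrow> x = y)"

lemma single_eq [simp]: "single (\<lambda>v. v = a)"
  by (simp add: single_def)

lemma single_conj [simp]: "single S \<Longrightarrow> single (\<lambda>v. P \<and> S v)"
  by (auto simp: single_def)

lemma den_app_single [simp]:
  assumes "f < d" "wf_trm d s" "single (den d e s)"
  shows "den d e (app f s) = (\<lambda>v. \<exists>x. den d e s x \<and> kpair x v \<epsilon> e f)"
  using assms(3) unfolding den_app[OF assms(1,2)] single_def fun_eq_iff by blast

lemma wf_app2 [simp]: "f < d \<Longrightarrow> wf_trm d s \<Longrightarrow> wf_trm d t \<Longrightarrow> wf_trm d (app2 f s t)"
  by (simp add: app2_def)

lemma den_app2 [simp]:
  assumes "f < d" "wf_trm d s" "wf_trm d t" "single (den d e s)" "single (den d e t)"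
  shows "den d e (app2 f s t) =
    (\<lambda>v. \<exists>x. den d e s x \<and> (\<exists>y. den d e t y \<and> kpair (kpair x y) v \<epsilon> e f))"
proof -
  have "den d e (opair s t) = (\<lambda>v. \<exists>x y. den d e s x \<and> den d e t y \<and> v = kpair x y)"
    using assms(4) unfolding den_opair[OF assms(2,3)] single_def fun_eq_iff by blast
  moreover from this have "single (den d e (opair s t))"
    using assms(4,5) unfolding single_def by auto
  ultimately show ?thesis
    using assms unfolding app2_def by (subst den_app_single) auto
qed

lemma holds_related_single [simp]:
  assumes "r < d" "wf_trm d s" "wf_trm d t" "single (den d e s)"
  shows "holds d e (related r s t) \<longleftrightarrow>
    (\<exists>x. den d e s x \<and> (\<exists>y. den d e t y \<and> kpair x y \<epsilon> e r))"
  using assms(4) unfolding holds_related[OF assms(1-3)] single_def by blast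

lemma
  assumes "add K < d" "n < d" "wf_trm d s"
  shows wf_r_diff [simp]: "wf_trm d (s \<ominus>\<^bsub>K\<^esub> V n)"
    and den_r_diff [simp]: "den d e (s \<ominus>\<^bsub>K\<^esub> V n) =
      (\<lambda>v. \<exists>w. kpair (kpair v (e n)) w \<epsilon> e (add K) \<and> den d e s w)"
proof -
  let ?T = "\<lambda>e v. \<exists>w. kpair (kpair v (e n)) w \<epsilon> e (add K) \<and> den d e s w"
  have *: "holds d' e' ((s \<ominus>\<^bsub>K\<^esub> V n) v) \<longleftrightarrow> ?T e (e' v)"
    if "d \<le> d'" "\<forall>i<d. e' i = e i" "v < d'" for e d' e' v
    using that assms(1,2) wf_trm_mono[OF assms(3) that(1)] den_mono[OF assms(3) that(1,2)]
    by (simp add: r_diff_def r_add_def)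
  show "wf_trm d (s \<ominus>\<^bsub>K\<^esub> V n)" by (rule wf_trmI(1)[where T = ?T]) (rule *)
  show "den d e (s \<ominus>\<^bsub>K\<^esub> V n) = ?T e" by (rule wf_trmI(2)[where T = ?T]) (rule *)
qed

lemma
  assumes "mul K < d" "one K < d" "n < d"
  shows wf_r_inv [simp]: "wf_trm d (r_inv K (V n))"
    and den_r_inv [simp]: "den d e (r_inv K (V n)) =
      (\<lambda>v. kpair (kpair v (e n)) (e (one K)) \<epsilon> e (mul K))"
proof -
  let ?T = "\<lambda>e v. kpair (kpair v (e n)) (e (one K)) \<epsilon> e (mul K)"
  have *: "holds d' e' (r_inv K (V n) v) \<longleftrightarrow> ?T e (e' v)"
    if "d \<le> d'" "\<forall>i<d. e' i = e i" "v < d'" for e d' e' v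
    using that assms by (simp add: r_inv_def r_mul_def)
  show "wf_trm d (r_inv K (V n))" by (rule wf_trmI(1)[where T = ?T]) (rule *)
  show "den d e (r_inv K (V n)) = ?T e" by (rule wf_trmI(2)[where T = ?T]) (rule *)
qed

text \<open>The distance is read relationally because \<open>dd\<close> is not yet known to be a
  function here.\<close>

definition lower :: "'a \<Rightarrow> 'a \<Rightarrow> 'a \<Rightarrow> 'a \<Rightarrow> 'a \<Rightarrow> bool" where
  "lower le dd x J r \<longleftrightarrow> (\<forall>y. y \<epsilon> J \<longrightarrow> (\<exists>q. kpair (kpair x y) q \<epsilon> dd \<and> kpair r q \<epsilon> le))"

definition is_set_dist :: "'a \<Rightarrow> 'a \<Rightarrow> 'a \<Rightarrow> 'a \<Rightarrow> 'a \<Rightarrow> 'a \<Rightarrow> bool" where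
  "is_set_dist R le dd x J r \<longleftrightarrow> r \<epsilon> R \<and> lower le dd x J r \<and>
    (\<forall>s. s \<epsilon> R \<longrightarrow> lower le dd x J s \<longrightarrow> kpair s r \<epsilon> le)"

lemma
  assumes "carrier K < d" "leq K < d" "dd < d" "x < d" "J < d"
  shows wf_set_dist [simp]: "wf_trm d (set_dist K dd x J)"
    and den_set_dist [simp]: "den d e (set_dist K dd x J) =
      is_set_dist (e (carrier K)) (e (leq K)) (e dd) (e x) (e J)"
proof -
  let ?T = "\<lambda>e. is_set_dist (e (carrier K)) (e (leq K)) (e dd) (e x) (e J)"
  have *: "holds d' e' (set_dist K dd x J v) \<longleftrightarrow> ?T e (e' v)"
    if "d \<le> d'" "\<forall>i<d. e' i = e i" "v < d'" for e d' e' v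
    using that assms
    by (simp add: set_dist_def r_le_def is_set_dist_def lower_def)
  show "wf_trm d (set_dist K dd x J)" by (rule wf_trmI(1)[where T = ?T]) (rule *)
  show "den d e (set_dist K dd x J) = ?T e" by (rule wf_trmI(2)[where T = ?T]) (rule *)
qed

lemma
  assumes "carrier K < d" "leq K < d" "dd < d" "T < d" "J < d" "n < d"
  shows wf_neighbourhood [simp]: "wf_trm d (neighbourhood K T dd J n)"
    and den_neighbourhood [simp]: "den d e (neighbourhood K T dd J n) =
      (\<lambda>B. \<forall>x. x \<epsilon> B \<longleftrightarrow> x \<epsilon> e T \<and>
        (\<exists>r r' r''. is_set_dist (e (carrier K)) (e (leq K)) (e dd) x (e J) r \<and>
          is_set_dist (e (carrier K)) (e (leq K)) (e dd) x (e J) r' \<and>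
          is_set_dist (e (carrier K)) (e (leq K)) (e dd) x (e J) r'' \<and>
          pair (pair r r') (pair r'' (e n)) \<epsilon> e (leq K)))"
proof -
  let ?T = "\<lambda>e B. \<forall>x. x \<epsilon> B \<longleftrightarrow> x \<epsilon> e T \<and>
        (\<exists>r r' r''. is_set_dist (e (carrier K)) (e (leq K)) (e dd) x (e J) r \<and>
          is_set_dist (e (carrier K)) (e (leq K)) (e dd) x (e J) r' \<and>
          is_set_dist (e (carrier K)) (e (leq K)) (e dd) x (e J) r'' \<and>
          pair (pair r r') (pair r'' (e n)) \<epsilon> e (leq K))"
  have *: "holds d' e' (neighbourhood K T dd J n v) \<longleftrightarrow> ?T e (e' v)"
    if "d \<le> d'" "\<forall>i<d. e' i = e i" "v < d'" for e d' e' v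
    using that assms by (simp add: neighbourhood_def r_le_def)
  show "wf_trm d (neighbourhood K T dd J n)" by (rule wf_trmI(1)[where T = ?T]) (rule *)
  show "den d e (neighbourhood K T dd J n) = ?T e" by (rule wf_trmI(2)[where T = ?T]) (rule *)
qed

end

section \<open>The field of the statement\<close>

text \<open>The field consists of points of the model, and its carrier is no HOL type, so the axioms
  are stated for members of \<open>R\<close> with \<open>fapp\<close> in place of graphs.\<close>

locale real_field = zf_model +
  fixes R ad mu le zer unit :: 'a
  assumes ad_fun: "is_fun ad (cprod R R) R"
    and mu_fun: "is_fun mu (cprod R R) R"
    and zero_in: "zer \<epsilon> R" and one_in: "unit \<epsilon> R" and zero_neq_one: "zer \<noteq> unit"
    and add_assoc: "x \<epsilon> R \<Longrightarrow> y \<epsilon> R \<Longrightarrow> z \<epsilon> R \<Longrightarrow>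
      fapp ad (kpair (fapp ad (kpair x y)) z) = fapp ad (kpair x (fapp ad (kpair y z)))"
    and mult_assoc: "x \<epsilon> R \<Longrightarrow> y \<epsilon> R \<Longrightarrow> z \<epsilon> R \<Longrightarrow>
      fapp mu (kpair (fapp mu (kpair x y)) z) = fapp mu (kpair x (fapp mu (kpair y z)))"
    and distrib: "x \<epsilon> R \<Longrightarrow> y \<epsilon> R \<Longrightarrow> z \<epsilon> R \<Longrightarrow>
      fapp mu (kpair x (fapp ad (kpair y z))) =
      fapp ad (kpair (fapp mu (kpair x y)) (fapp mu (kpair x z)))"
    and add_comm: "x \<epsilon> R \<Longrightarrow> y \<epsilon> R \<Longrightarrow> fapp ad (kpair x y) = fapp ad (kpair y x)"
    and mult_comm: "x \<epsilon> R \<Longrightarrow> y \<epsilon> R \<Longrightarrow> fapp mu (kpair x y) = fapp mu (kpair y x)"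
    and add_zero: "x \<epsilon> R \<Longrightarrow> fapp ad (kpair x zer) = x"
    and mult_one: "x \<epsilon> R \<Longrightarrow> fapp mu (kpair x unit) = x"
    and negative: "x \<epsilon> R \<Longrightarrow> \<exists>y. y \<epsilon> R \<and> fapp ad (kpair x y) = zer"
    and reciprocal: "x \<epsilon> R \<Longrightarrow> x \<noteq> zer \<Longrightarrow> \<exists>y. y \<epsilon> R \<and> fapp mu (kpair x y) = unit"
    and le_total: "x \<epsilon> R \<Longrightarrow> y \<epsilon> R \<Longrightarrow> kpair x y \<epsilon> le \<or> kpair y x \<epsilon> le"
    and le_antisym: "x \<epsilon> R \<Longrightarrow> y \<epsilon> R \<Longrightarrow> kpair x y \<epsilon> le \<Longrightarrow> kpair y x \<epsilon> le \<Longrightarrow> x = y"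
    and le_trans: "x \<epsilon> R \<Longrightarrow> y \<epsilon> R \<Longrightarrow> z \<epsilon> R \<Longrightarrow> kpair x y \<epsilon> le \<Longrightarrow> kpair y z \<epsilon> le \<Longrightarrow> kpair x z \<epsilon> le"
    and add_mono: "x \<epsilon> R \<Longrightarrow> y \<epsilon> R \<Longrightarrow> z \<epsilon> R \<Longrightarrow> kpair x y \<epsilon> le \<Longrightarrow>
      kpair (fapp ad (kpair x z)) (fapp ad (kpair y z)) \<epsilon> le"
    and mult_nonneg: "x \<epsilon> R \<Longrightarrow> y \<epsilon> R \<Longrightarrow> kpair zer x \<epsilon> le \<Longrightarrow> kpair zer y \<epsilon> le \<Longrightarrow>
      kpair zer (fapp mu (kpair x y)) \<epsilon> le"

definition (in zf_model) interprets ::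
  "nat \<Rightarrow> (nat \<Rightarrow> 'a) \<Rightarrow> reals \<Rightarrow> 'a \<Rightarrow> 'a \<Rightarrow> 'a \<Rightarrow> 'a \<Rightarrow> 'a \<Rightarrow> 'a \<Rightarrow> bool" where
  "interprets d e K R ad mu le zer unit \<longleftrightarrow> carrier K < d \<and> add K < d \<and> mul K < d \<and>
    leq K < d \<and> zero K < d \<and> one K < d \<and> e (carrier K) = R \<and> e (add K) = ad \<and>
    e (mul K) = mu \<and> e (leq K) = le \<and> e (zero K) = zer \<and> e (one K) = unit"

lemma (in zf_model) real_field:
  assumes "interprets d e K R ad mu le zer unit" "holds d e (complete_ordered_field K)"
  shows "real_field (\<epsilon>) R ad mu le zer unit"
proof -
  note defs = interprets_def complete_ordered_field_def field_axioms_def order_axioms_def Let_def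
    r_le_def r_add_def r_mul_def
  \<comment> \<open>Functionality comes first: with it, all other axioms simplify from graphs to
    equations.\<close>
  have ad: "is_fun ad (cprod R R) R" and mu: "is_fun mu (cprod R R) R"
    using assms
    by (simp_all only: interprets_def complete_ordered_field_def field_axioms_def Let_def holds_and holds_maps2)
  note [simp] = assms(1)[unfolded interprets_def] less_SucI less_imp_neq is_fun_graph[OF ad] is_fun_graph[OF mu]
  note A = assms(2)[unfolded defs, simplified]
  have "real_field_axioms (\<epsilon>) R ad mu le zer unit"
    unfolding real_field_axioms_def
    by (intro conjI HOL.allI HOL.impI) (use A in meson)+
  then show ?thesis using zf_model_axioms by (simp add: real_field_def)
qed

context real_field
begin

section \<open>Arithmetic of ordered fields\<close>

abbreviation add_op (infixl "\<boxplus>" 65) where "x \<boxplus> y \<equiv> fapp ad (kpair x y)"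
abbreviation mul_op (infixl "\<boxtimes>" 70) where "x \<boxtimes> y \<equiv> fapp mu (kpair x y)"
abbreviation le_op (infix "\<sqsubseteq>" 50) where "x \<sqsubseteq> y \<equiv> kpair x y \<epsilon> le"
abbreviation (input) dist_in where "dist_in d x y \<equiv> fapp d (kpair x y)"

lemma add_in [simp]: "x \<epsilon> R \<Longrightarrow> y \<epsilon> R \<Longrightarrow> x \<boxplus> y \<epsilon> R"
  using is_fun_fapp[OF ad_fun] by simp

lemma mul_in [simp]: "x \<epsilon> R \<Longrightarrow> y \<epsilon> R \<Longrightarrow> x \<boxtimes> y \<epsilon> R"
  using is_fun_fapp[OF mu_fun] by simp

declare zero_in [simp] one_in [simp] add_zero [simp] mult_one [simp]

lemma le_refl [simp]: "x \<epsilon> R \<Longrightarrow> x \<sqsubseteq> x"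
  using le_total by blast

lemma zero_add [simp]: "x \<epsilon> R \<Longrightarrow> zer \<boxplus> x = x"
  by (subst add_comm) simp_all

lemma add_le_cancel:
  assumes "x \<epsilon> R" "y \<epsilon> R" "z \<epsilon> R" "x \<boxplus> z \<sqsubseteq> y \<boxplus> z"
  shows "x \<sqsubseteq> y"
proof -
  obtain w where w: "w \<epsilon> R" "z \<boxplus> w = zer" using negative assms by blast
  have "(x \<boxplus> z) \<boxplus> w \<sqsubseteq> (y \<boxplus> z) \<boxplus> w" using assms w(1) by - (rule add_mono, auto)
  moreover have "(v \<boxplus> z) \<boxplus> w = v" if "v \<epsilon> R" for v
    using assms(3) w that by (simp add: add_assoc)
  ultimately show ?thesis using assms by simp
qed

lemma add_cancel:
  assumes "x \<epsilon> R" "y \<epsilon> R" "z \<epsilon> R" "x \<boxplus> z = y \<boxplus> z"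
  shows "x = y"
proof (rule le_antisym)
  show "x \<sqsubseteq> y" using assms by (intro add_le_cancel[OF assms(1-3)]) simp_all
  show "y \<sqsubseteq> x" using assms by (intro add_le_cancel[OF assms(2,1,3)]) simp
qed (use assms in auto)

lemma mult_zero:
  assumes "x \<epsilon> R"
  shows "x \<boxtimes> zer = zer"
proof -
  have "x \<boxtimes> zer \<boxplus> x \<boxtimes> zer = zer \<boxplus> x \<boxtimes> zer"
    using distrib[of x zer zer] assms by simp
  then show ?thesis using assms by - (rule add_cancel[of _ zer "x \<boxtimes> zer"], simp_all)
qed

text \<open>The axiom only covers products of nonnegative elements, so it is applied to
  \<open>c\<close> and the difference \<open>y \<boxplus> w\<close>.\<close>

lemma mult_left_mono:
  assumes "x \<epsilon> R" "y \<epsilon> R" "c \<epsilon> R" "x \<sqsubseteq> y" "zer \<sqsubseteq> c"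
  shows "c \<boxtimes> x \<sqsubseteq> c \<boxtimes> y"
proof -
  obtain w where w: "w \<epsilon> R" "x \<boxplus> w = zer" using negative assms by blast
  have "zer \<sqsubseteq> y \<boxplus> w" using add_mono[of x y w] assms w by simp
  then have "zer \<sqsubseteq> c \<boxtimes> (y \<boxplus> w)" using assms w by - (rule mult_nonneg, auto)
  then have "zer \<boxplus> c \<boxtimes> x \<sqsubseteq> c \<boxtimes> (y \<boxplus> w) \<boxplus> c \<boxtimes> x" using assms w by - (rule add_mono, auto)
  moreover have "c \<boxtimes> (y \<boxplus> w) \<boxplus> c \<boxtimes> x = c \<boxtimes> y"
    using assms w add_comm[of w x] by (simp add: distrib[symmetric] add_assoc)
  ultimately show ?thesis using assms by simp
qed

text \<open>Otherwise the negative \<open>w\<close> of \<open>unit\<close> is nonnegative, and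
  multiplying \<open>unit \<sqsubseteq> zer\<close> by it forces \<open>w = zer\<close>.\<close>

lemma zero_le_one: "zer \<sqsubseteq> unit"
proof (rule ccontr)
  assume "\<not> zer \<sqsubseteq> unit"
  then have le: "unit \<sqsubseteq> zer" using le_total[of zer unit] by simp
  obtain w where w: "w \<epsilon> R" "unit \<boxplus> w = zer" using negative one_in by blast
  have "zer \<sqsubseteq> w" using add_mono[OF _ _ _ le, of w] w by simp
  then have "w \<boxtimes> unit \<sqsubseteq> w \<boxtimes> zer" using w le by - (rule mult_left_mono, simp_all)
  then have "w \<sqsubseteq> zer" using w by (simp add: mult_zero)
  then have "w = zer" using \<open>zer \<sqsubseteq> w\<close> w by - (rule le_antisym, simp_all)
  then show False using w zero_neq_one by simp
qed

lemma not_one_le_zero: "\<not> unit \<sqsubseteq> zer"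
  using zero_le_one le_antisym[of unit zer] zero_neq_one by auto

lemma le_add:
  assumes "x \<epsilon> R" "y \<epsilon> R" "zer \<sqsubseteq> y"
  shows "x \<sqsubseteq> x \<boxplus> y"
  using add_mono[OF _ _ _ assms(3), of x] assms add_comm[of x y] by simp

lemma add_mono2:
  assumes "x \<epsilon> R" "y \<epsilon> R" "x' \<epsilon> R" "y' \<epsilon> R" "x \<sqsubseteq> x'" "y \<sqsubseteq> y'"
  shows "x \<boxplus> y \<sqsubseteq> x' \<boxplus> y'"
proof (rule le_trans[of _ "x' \<boxplus> y"])
  show "x' \<boxplus> y \<sqsubseteq> x' \<boxplus> y'"
    using add_mono[of y y' x'] assms add_comm[of y x'] add_comm[of y' x'] by simp
qed (use assms add_mono in auto)

text \<open>The last conjunct has the form of a rewrite rule turning the relational inverse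
  \<open>r_inv\<close> into \<open>v = i\<close>.\<close>

lemma reciprocal_unique:
  assumes "n \<epsilon> R" "n \<noteq> zer"
  shows "\<exists>i. i \<epsilon> R \<and> i \<boxtimes> n = unit \<and> (\<forall>v. v \<epsilon> R \<and> v \<boxtimes> n = unit \<longleftrightarrow> v = i)"
proof -
  obtain i where i: "i \<epsilon> R" "n \<boxtimes> i = unit" using reciprocal assms by blast
  have "v = i" if "v \<epsilon> R" "v \<boxtimes> n = unit" for v
    using mult_assoc[of v n i] that i assms mult_comm[of unit i] by simp
  then show ?thesis using i assms mult_comm[of n i] by metis
qed

definition positive_nat :: "'a \<Rightarrow> bool" where
  "positive_nat n \<longleftrightarrow> n \<epsilon> R \<and> (\<forall>I. (\<forall>x. x \<epsilon> I \<longrightarrow> x \<epsilon> R) \<and> unit \<epsilon> I \<and>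
    (\<forall>x. x \<epsilon> I \<longrightarrow> x \<boxplus> unit \<epsilon> I) \<longrightarrow> n \<epsilon> I)"

lemma positive_nat_one: "positive_nat unit"
  by (auto simp: positive_nat_def)

text \<open>The induction in \<open>positive_nat\<close> ranges over sets of the model, so the reals
  above \<open>unit\<close> must first be separated as such a set. Seen from HOL, \<open>n\<close>
  may be a nonstandard number.\<close>

lemma one_le_positive_nat:
  assumes "positive_nat n"
  shows "n \<epsilon> R" "unit \<sqsubseteq> n"
proof -
  show "n \<epsilon> R" using assms by (simp add: positive_nat_def)
  have "definable (\<lambda>e. unit \<sqsubseteq> e 0)" by (rule definable_intros)+
  then obtain I where I: "\<And>x. x \<epsilon> I \<longleftrightarrow> x \<epsilon> R \<and> unit \<sqsubseteq> x"
    using separation[of "\<lambda>x. unit \<sqsubseteq> x" R] by auto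
  have "unit \<sqsubseteq> x \<boxplus> unit" if "x \<epsilon> R" "unit \<sqsubseteq> x" for x
    using that le_trans[OF _ _ _ that(2) le_add[of x unit]] zero_le_one by simp
  then have "(\<forall>x. x \<epsilon> I \<longrightarrow> x \<epsilon> R) \<and> unit \<epsilon> I \<and> (\<forall>x. x \<epsilon> I \<longrightarrow> x \<boxplus> unit \<epsilon> I)"
    by (simp add: I)
  then have "n \<epsilon> I" using assms unfolding positive_nat_def by blast
  then show "unit \<sqsubseteq> n" by (simp add: I)
qed

section \<open>Metrics and quasi-isometries read in the model\<close>

definition metric :: "'a \<Rightarrow> 'a \<Rightarrow> bool" where
  "metric S d \<longleftrightarrow> is_fun d (cprod S S) R \<and>
    (\<forall>x y. x \<epsilon> S \<longrightarrow> y \<epsilon> S \<longrightarrow>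
      zer \<sqsubseteq> dist_in d x y \<and> (dist_in d x y = zer \<longleftrightarrow> x = y) \<and> dist_in d x y = dist_in d y x) \<and>
    (\<forall>x y z. x \<epsilon> S \<longrightarrow> y \<epsilon> S \<longrightarrow> z \<epsilon> S \<longrightarrow> dist_in d x z \<sqsubseteq> dist_in d x y \<boxplus> dist_in d y z)"

text \<open>\<open>near\<close> says that the distance of \<open>x\<close> from \<open>J\<close> exists and is at most \<open>n\<close>.\<close>

definition near :: "'a \<Rightarrow> 'a \<Rightarrow> 'a \<Rightarrow> 'a \<Rightarrow> bool" where
  "near d J n x \<longleftrightarrow> (\<exists>r. is_set_dist R le d x J r \<and> r \<sqsubseteq> n)"

text \<open>The lower bound is solved for the distance in the domain, which rids it of division and
  subtraction.\<close>

definition coarse_bounds :: "'a \<Rightarrow> 'a \<Rightarrow> 'a \<Rightarrow> 'a \<Rightarrow> 'a \<Rightarrow> bool" where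
  "coarse_bounds S d e f n \<longleftrightarrow> (\<forall>x y. x \<epsilon> S \<longrightarrow> y \<epsilon> S \<longrightarrow>
    dist_in d x y \<sqsubseteq> n \<boxtimes> (dist_in e (fapp f x) (fapp f y) \<boxplus> n) \<and>
    dist_in e (fapp f x) (fapp f y) \<sqsubseteq> n \<boxtimes> dist_in d x y \<boxplus> n)"

definition coarse_equiv :: "'a \<Rightarrow> 'a \<Rightarrow> 'a \<Rightarrow> 'a \<Rightarrow> 'a \<Rightarrow> bool" where
  "coarse_equiv S d T e f \<longleftrightarrow> is_fun f S T \<and> (\<exists>n. positive_nat n \<and>
    (\<exists>J. (\<forall>y. y \<epsilon> J \<longleftrightarrow> (\<exists>x. x \<epsilon> S \<and> y = fapp f x)) \<and> (\<forall>y. y \<epsilon> T \<longrightarrow> near e J n y)) \<and>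
    coarse_bounds S d e f n)"

lemma holds_metric_space:
  assumes "interprets d e K R ad mu le zer unit" "S < d" "dd < d"
  shows "holds d e (metric_space K S dd) \<longleftrightarrow> metric (e S) (e dd)"
proof (cases "is_fun (e dd) (cprod (e S) (e S)) R")
  case True
  note graph = is_fun_graph[OF ad_fun] is_fun_graph[OF True]
  have "fapp (e dd) (kpair x y) \<epsilon> R" if "x \<epsilon> e S" "y \<epsilon> e S" for x y
    using is_fun_fapp[OF True] that by simp
  then show ?thesis
    using assms True
    by (simp add: metric_space_def interprets_def Let_def r_le_def r_add_def
        metric_def graph cong: imp_cong)
next
  case False
  then show ?thesis using assms by (simp add: metric_space_def metric_def interprets_def Let_def)
qed

lemma holds_positive_natural:
  assumes "interprets d e K R ad mu le zer unit" "n < d"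
  shows "holds d e (positive_natural K n) \<longleftrightarrow> positive_nat (e n)"
  using assms
  by (auto simp: positive_natural_def positive_nat_def interprets_def Let_def r_add_def
      is_fun_graph[OF ad_fun] cong: imp_cong)

lemma set_dist_unique:
  "is_set_dist R le d x J r \<Longrightarrow> is_set_dist R le d x J s \<Longrightarrow> r = s"
  unfolding is_set_dist_def using le_antisym by blast

text \<open>Multiplication by \<open>n\<close>, or back by its nonnegative reciprocal
  \<open>i\<close>, passes between the two forms; \<open>w\<close> is \<open>i \<boxtimes> x\<close>
  minus \<open>n\<close>.\<close>

lemma coarse_bounds_iff:
  assumes n: "n \<epsilon> R" "n \<noteq> zer" "zer \<sqsubseteq> n" and i: "i \<epsilon> R" "i \<boxtimes> n = unit"
    and x: "x \<epsilon> R" and y: "y \<epsilon> R"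
  shows "(\<exists>w. w \<epsilon> R \<and> w \<boxplus> n = i \<boxtimes> x \<and> w \<sqsubseteq> y) \<longleftrightarrow> x \<sqsubseteq> n \<boxtimes> (y \<boxplus> n)"
proof
  have nix: "n \<boxtimes> (i \<boxtimes> x) = x"
    using mult_assoc[of n i x] n i x mult_comm[of n i] mult_comm[of unit x] by simp
  assume "\<exists>w. w \<epsilon> R \<and> w \<boxplus> n = i \<boxtimes> x \<and> w \<sqsubseteq> y"
  then obtain w where w: "w \<epsilon> R" "w \<boxplus> n = i \<boxtimes> x" "w \<sqsubseteq> y" by blast
  then have "i \<boxtimes> x \<sqsubseteq> y \<boxplus> n" using add_mono[of w y n] y n by simp
  then have "n \<boxtimes> (i \<boxtimes> x) \<sqsubseteq> n \<boxtimes> (y \<boxplus> n)" using n i x y by - (rule mult_left_mono, simp_all)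
  then show "x \<sqsubseteq> n \<boxtimes> (y \<boxplus> n)" by (simp add: nix)
next
  assume le: "x \<sqsubseteq> n \<boxtimes> (y \<boxplus> n)"
  have i0: "zer \<sqsubseteq> i"
  proof (rule ccontr)
    assume "\<not> zer \<sqsubseteq> i"
    then have "i \<sqsubseteq> zer" using le_total[of zer i] i by auto
    then have "n \<boxtimes> i \<sqsubseteq> n \<boxtimes> zer" using n i by - (rule mult_left_mono, simp_all)
    then show False using n i not_one_le_zero by (simp add: mult_zero mult_comm[of n i])
  qed
  obtain m where m: "m \<epsilon> R" "n \<boxplus> m = zer" using negative n by blast
  define w where "w = i \<boxtimes> x \<boxplus> m"
  have w: "w \<epsilon> R" "w \<boxplus> n = i \<boxtimes> x"
    using m n i x add_comm[of m n] by (simp_all add: w_def add_assoc)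
  have "i \<boxtimes> x \<sqsubseteq> i \<boxtimes> (n \<boxtimes> (y \<boxplus> n))" using le i0 n i x y by - (rule mult_left_mono, simp_all)
  also have "i \<boxtimes> (n \<boxtimes> (y \<boxplus> n)) = y \<boxplus> n"
    using n i y mult_comm[of unit "y \<boxplus> n"] by (simp add: mult_assoc[symmetric])
  finally have "w \<sqsubseteq> y" using w n y by - (rule add_le_cancel[of w y n], simp_all)
  with w show "\<exists>w. w \<epsilon> R \<and> w \<boxplus> n = i \<boxtimes> x \<and> w \<sqsubseteq> y" by blast
qed

lemma holds_quasi_isometry:
  assumes K: "interprets d e K R ad mu le zer unit" "S < d" "dd < d" "T < d" "ee < d" "f < d"
    and metric: "metric (e S) (e dd)" "metric (e T) (e ee)"
  shows "holds d e (quasi_isometry K S dd T ee f) \<longleftrightarrow> coarse_equiv (e S) (e dd) (e T) (e ee) (e f)"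
proof (cases "is_fun (e f) (e S) (e T)")
  case True
  have dd: "is_fun (e dd) (cprod (e S) (e S)) R" and ee: "is_fun (e ee) (cprod (e T) (e T)) R"
    using metric by (auto simp: metric_def)
  note graph = is_fun_graph[OF ad_fun] is_fun_graph[OF mu_fun] is_fun_graph[OF dd]
    is_fun_graph[OF ee] is_fun_graph[OF True]
  have f_in: "fapp (e f) x \<epsilon> e T" if "x \<epsilon> e S" for x using is_fun_fapp[OF True] that by blast
  have dd_in: "dist_in (e dd) x y \<epsilon> R" if "x \<epsilon> e S" "y \<epsilon> e S" for x y
    using is_fun_fapp[OF dd] that by simp
  have ee_in: "dist_in (e ee) x y \<epsilon> R" if "x \<epsilon> e T" "y \<epsilon> e T" for x y
    using is_fun_fapp[OF ee] that by simp
  let ?bounds = "\<lambda>N. (\<^bold>\<forall>x\<^bold>\<in>S. \<^bold>\<forall>y\<^bold>\<in>S.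
          let dS = app2 dd (V x) (V y); dT = app2 ee (app f (V x)) (app f (V y)) in
            r_inv K (V N) \<otimes>\<^bsub>K\<^esub> dS \<ominus>\<^bsub>K\<^esub> V N \<preceq>\<^bsub>K\<^esub> dT \<^bold>\<and>
            dT \<preceq>\<^bsub>K\<^esub> V N \<otimes>\<^bsub>K\<^esub> dS \<oplus>\<^bsub>K\<^esub> V N)"
  have bounds: "holds (Suc d) (e(d := n)) (?bounds d) \<longleftrightarrow> coarse_bounds (e S) (e dd) (e ee) (e f) n"
    if "positive_nat n" for n
  proof -
    note n = one_le_positive_nat[OF that]
    have n': "n \<noteq> zer" using n not_one_le_zero by auto
    have n0: "zer \<sqsubseteq> n" using n zero_le_one le_trans[of zer unit n] by simp
    obtain i where i: "i \<epsilon> R" "i \<boxtimes> n = unit" "\<And>v. v \<epsilon> R \<and> v \<boxtimes> n = unit \<longleftrightarrow> v = i"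
      using reciprocal_unique[OF n(1) n'] by blast
    have i3: "v \<epsilon> R \<and> unit = v \<boxtimes> n \<longleftrightarrow> v = i" for v using i(3)[of v] by auto
    \<comment> \<open>The difference was not simplified as single-valued, so three values of it
      occur in the pair; cancellation identifies them.\<close>
    have diff: "(\<exists>x. x \<epsilon> R \<and> x \<boxplus> n = c \<and> (\<exists>x'. x' \<epsilon> R \<and> x' \<boxplus> n = c \<and>
        (\<exists>x''. x'' \<epsilon> R \<and> x'' \<boxplus> n = c \<and> pair (pair x x') (pair x'' y) \<epsilon> le))) \<longleftrightarrow>
      (\<exists>w. w \<epsilon> R \<and> w \<boxplus> n = c \<and> w \<sqsubseteq> y)" for c y
      using add_cancel[OF _ _ n(1)] by metis
    have "holds (Suc d) (e(d := n)) (?bounds d) \<longleftrightarrow> (\<forall>x y. x \<epsilon> e S \<longrightarrow> y \<epsilon> e S \<longrightarrow>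
      (\<exists>w. w \<epsilon> R \<and> w \<boxplus> n = i \<boxtimes> dist_in (e dd) x y \<and> w \<sqsubseteq> dist_in (e ee) (fapp (e f) x) (fapp (e f) y)) \<and>
      dist_in (e ee) (fapp (e f) x) (fapp (e f) y) \<sqsubseteq> n \<boxtimes> dist_in (e dd) x y \<boxplus> n)"
      using K n i(1)
      by (simp add: interprets_def Let_def r_le_def r_add_def r_mul_def graph i3 diff f_in dd_in ee_in
          cong: imp_cong conj_cong)
    also have "\<dots> \<longleftrightarrow> coarse_bounds (e S) (e dd) (e ee) (e f) n"
      unfolding coarse_bounds_def using coarse_bounds_iff[OF n(1) n' n0 i(1,2) dd_in ee_in[OF f_in f_in]]
      by blast
    finally show ?thesis .
  qed
  \<comment> \<open>The same triplication for the distance from a set, resolved by uniqueness of the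
    infimum.\<close>
  have near: "(\<exists>r. is_set_dist R le dd x J r \<and> (\<exists>r'. is_set_dist R le dd x J r' \<and>
      (\<exists>r''. is_set_dist R le dd x J r'' \<and> pair (pair r r') (pair r'' n) \<epsilon> le))) \<longleftrightarrow> near dd J n x"
    for dd J n x
    unfolding near_def using set_dist_unique[of dd x J] by metis
  have image: "holds (Suc d) (e(d := n)) (\<^bold>\<exists>J. image_of f S J \<^bold>\<and> neighbourhood K T ee J d \<^bold>\<simeq> V T)
      \<longleftrightarrow> (\<exists>J. (\<forall>y. y \<epsilon> J \<longleftrightarrow> (\<exists>x. x \<epsilon> e S \<and> y = fapp (e f) x)) \<and>
        (\<forall>y. y \<epsilon> e T \<longrightarrow> near (e ee) J n y))" for n
  proof -
    \<comment> \<open>A neighbourhood lies in \<open>T\<close> by definition, so its equality with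
      \<open>T\<close> is only the inclusion of \<open>T\<close>.\<close>
    have absorb: "(p \<longleftrightarrow> p \<and> q) \<longleftrightarrow> (p \<longrightarrow> q)" for p q by blast
    show ?thesis
      using K by (simp add: interprets_def near graph absorb cong: conj_cong)
  qed
  have nat: "holds (Suc d) (e(d := n)) (positive_natural K d) \<longleftrightarrow> positive_nat n" for n
    using K holds_positive_natural[of "Suc d" "e(d := n)" K d] by (simp add: interprets_def)
  have "holds d e (quasi_isometry K S dd T ee f) \<longleftrightarrow>
    (\<exists>n. positive_nat n \<and>
    (\<exists>J. (\<forall>y. y \<epsilon> J \<longleftrightarrow> (\<exists>x. x \<epsilon> e S \<and> y = fapp (e f) x)) \<and> (\<forall>y. y \<epsilon> e T \<longrightarrow> near (e ee) J n y)) \<and>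
      holds (Suc d) (e(d := n)) (?bounds d))"
    unfolding quasi_isometry_def holds_and holds_ex[of d e] nat image
    using K True by simp
  then show ?thesis
    unfolding coarse_equiv_def using bounds True by blast
next
  case False
  then show ?thesis using K by (simp add: quasi_isometry_def coarse_equiv_def)
qed

end

section \<open>Spaces with levels\<close>

text \<open>The set \<open>f\<close> comes from separation on the product; \<open>F\<close>, picked
  in HOL, merely describes its values, which \<open>P\<close> determines uniquely.\<close>

lemma (in zf_model) ex_fun:
  assumes "definable (\<lambda>e. P (e 0) (e (Suc 0)))"
    and "\<And>x. x \<epsilon> A \<Longrightarrow> \<exists>y. y \<epsilon> B \<and> (\<forall>z. P x z \<longleftrightarrow> z = y)"
  shows "\<exists>f. is_fun f A B \<and> (\<forall>x. x \<epsilon> A \<longrightarrow> P x (fapp f x))"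
proof -
  let ?Q = "\<lambda>p. \<exists>x y. p = kpair x y \<and> P x y"
  \<comment> \<open>Under the two quantifiers of \<open>?Q\<close> the inner \<open>y\<close> has
    index 0 and \<open>x\<close> index 1, so the arguments of \<open>P\<close> must be
    swapped.\<close>
  have "definable (\<lambda>e. P (e (Suc 0)) (e 0))"
    using definable_ren[OF assms(1), of "\<lambda>i. if i = 0 then Suc 0 else 0"] by simp
  then have "definable (\<lambda>e. ?Q (e 0))"
    by (intro definable_ex definable_conj definable_eq definable_term_pair definable_term_var)
  then obtain f where f: "\<And>p. p \<epsilon> f \<longleftrightarrow> p \<epsilon> cprod A B \<and> ?Q p"
    using separation[of ?Q "cprod A B"] by blast
  obtain F where F: "\<And>x. x \<epsilon> A \<Longrightarrow> F x \<epsilon> B" "\<And>x z. x \<epsilon> A \<Longrightarrow> P x z \<longleftrightarrow> z = F x"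
    using assms(2) by metis
  have "p \<epsilon> f \<longleftrightarrow> (\<exists>x. x \<epsilon> A \<and> p = kpair x (F x))" for p
    unfolding f mem_cprod using F by auto
  then have "is_fun f A B" "\<And>x. x \<epsilon> A \<Longrightarrow> fapp f x = F x"
    using is_funI[of f A F B] F(1) by blast+
  then show ?thesis using F(2) by auto
qed

context real_field
begin

lemma le_add_right: "x \<epsilon> R \<Longrightarrow> y \<epsilon> R \<Longrightarrow> z \<epsilon> R \<Longrightarrow> x \<sqsubseteq> y \<Longrightarrow> zer \<sqsubseteq> z \<Longrightarrow> x \<sqsubseteq> y \<boxplus> z"
  using le_trans[of x y "y \<boxplus> z"] le_add[of y z] by simp

lemma le_add_left: "x \<epsilon> R \<Longrightarrow> y \<epsilon> R \<Longrightarrow> z \<epsilon> R \<Longrightarrow> x \<sqsubseteq> z \<Longrightarrow> zer \<sqsubseteq> y \<Longrightarrow> x \<sqsubseteq> y \<boxplus> z"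
  using le_add_right[of x z y] add_comm[of y z] by simp

lemma not_add_one_le: "x \<epsilon> R \<Longrightarrow> \<not> x \<boxplus> unit \<sqsubseteq> x"
  using add_le_cancel[of unit zer x] not_one_le_zero add_comm[of x unit] by auto

lemma metricD:
  assumes "metric S d" "x \<epsilon> S" "y \<epsilon> S"
  shows "dist_in d x y \<epsilon> R" "zer \<sqsubseteq> dist_in d x y" "dist_in d x y = zer \<longleftrightarrow> x = y"
    "dist_in d x y = dist_in d y x"
  using is_fun_fapp[of d "cprod S S" R "kpair x y"] assms unfolding metric_def kpair_mem_cprod
  by blast+

lemma lower_iff:
  assumes "metric T d" "\<And>y. y \<epsilon> J \<Longrightarrow> y \<epsilon> T" "x \<epsilon> T"
  shows "lower le d x J r \<longleftrightarrow> (\<forall>y. y \<epsilon> J \<longrightarrow> r \<sqsubseteq> dist_in d x y)"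
proof -
  have d: "is_fun d (cprod T T) R" using assms(1) by (simp add: metric_def)
  have "kpair (kpair x y) q \<epsilon> d \<longleftrightarrow> q = dist_in d x y" if "y \<epsilon> J" for y q
    using assms(2)[OF that] assms(3) by (simp add: is_fun_graph[OF d])
  then show ?thesis unfolding lower_def by simp
qed

lemma near_self:
  assumes d: "metric T d" and J: "\<And>y. y \<epsilon> J \<Longrightarrow> y \<epsilon> T" and x: "x \<epsilon> J"
  shows "near d J unit x"
proof -
  note J' = J[OF x]
  have "s \<sqsubseteq> zer" if "\<forall>y. y \<epsilon> J \<longrightarrow> s \<sqsubseteq> dist_in d x y" for s
    using that x metricD(3)[OF d J' J'] by metis
  moreover have "lower le d x J s \<longleftrightarrow> (\<forall>y. y \<epsilon> J \<longrightarrow> s \<sqsubseteq> dist_in d x y)" for s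
    using J by (intro lower_iff[OF d _ J'])
  ultimately have "is_set_dist R le d x J zer"
    unfolding is_set_dist_def using metricD(2)[OF d J' J] by simp
  then show ?thesis using zero_le_one by (auto simp: near_def)
qed

text \<open>The infimum need not be attained, so one unit is conceded: if all of \<open>J\<close>
  were at distance \<open>n \<boxplus> unit\<close> or more, that number would be a lower bound
  exceeding an infimum that is at most \<open>n\<close>.\<close>

lemma near_imp:
  assumes d: "metric T d" and J: "\<And>y. y \<epsilon> J \<Longrightarrow> y \<epsilon> T" and x: "x \<epsilon> T" and n: "n \<epsilon> R"
    and near: "near d J n x"
  shows "\<exists>y. y \<epsilon> J \<and> \<not> n \<boxplus> unit \<sqsubseteq> dist_in d x y"
proof (rule ccontr)
  assume "\<not> ?thesis"
  moreover have "lower le d x J s \<longleftrightarrow> (\<forall>y. y \<epsilon> J \<longrightarrow> s \<sqsubseteq> dist_in d x y)" for s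
    using J by (intro lower_iff[OF d _ x])
  ultimately have "lower le d x J (n \<boxplus> unit)" by blast
  moreover obtain r where "is_set_dist R le d x J r" "r \<sqsubseteq> n" using near by (auto simp: near_def)
  ultimately have "n \<boxplus> unit \<sqsubseteq> n"
    using n le_trans[of "n \<boxplus> unit" r n] by (simp add: is_set_dist_def)
  then show False using not_add_one_le n by blast
qed

definition larger :: "'a \<Rightarrow> 'a \<Rightarrow> 'a" where
  "larger r s = (if r \<sqsubseteq> s then s else r)"

lemma larger_ge:
  assumes "r \<epsilon> R" "s \<epsilon> R"
  shows "larger r s \<epsilon> R" "r \<sqsubseteq> larger r s" "s \<sqsubseteq> larger r s"
  using assms le_total[of r s] by (auto simp: larger_def)

lemma larger_comm: "r \<epsilon> R \<Longrightarrow> s \<epsilon> R \<Longrightarrow> larger r s = larger s r"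
  using le_total[of r s] le_antisym[of r s] by (auto simp: larger_def)

text \<open>One formula for both spaces: \<open>Q\<close> is equality for the space over
  \<open>Z\<close>, where the value \<open>unit\<close> never arises, and membership in a common
  element of \<open>Z\<close> for the space over its union.\<close>

definition level_dist :: "('a \<Rightarrow> 'a \<Rightarrow> bool) \<Rightarrow> 'a \<Rightarrow> 'a \<Rightarrow> 'a \<Rightarrow> 'a \<Rightarrow> 'a" where
  "level_dist Q a r b s =
    (if a = b \<and> r = s then zer else if r = s \<and> Q a b then unit else larger r s)"

text \<open>A path between different fibres has a leg that leaves the first fibre and a leg that
  enters the last one; these are at least \<open>r\<close> and at least \<open>t\<close>, hence the
  sum is at least the larger. Within a fibre it is enough that nonzero distances are at least
  \<open>unit\<close>.\<close>

lemma level_dist_triangle: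
  assumes Q: "\<And>a b. Q a b \<Longrightarrow> Q b a" "\<And>a b c. Q a b \<Longrightarrow> Q b c \<Longrightarrow> Q a c"
    and levels: "r \<epsilon> R" "s \<epsilon> R" "t \<epsilon> R" "unit \<sqsubseteq> r" "unit \<sqsubseteq> s" "unit \<sqsubseteq> t"
  shows "level_dist Q a r c t \<sqsubseteq> level_dist Q a r b s \<boxplus> level_dist Q b s c t"
proof -
  have in_R: "level_dist Q a r b s \<epsilon> R" if "r \<epsilon> R" "s \<epsilon> R" for a r b s
    using that larger_ge by (auto simp: level_dist_def)
  have ge1: "unit \<sqsubseteq> level_dist Q a r b s"
    if "\<not> (a = b \<and> r = s)" "r \<epsilon> R" "s \<epsilon> R" "unit \<sqsubseteq> r" for a r b s
    using that larger_ge[of r s] le_trans[of unit r "larger r s"] by (auto simp: level_dist_def)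
  have nonneg: "zer \<sqsubseteq> level_dist Q a r b s" if "r \<epsilon> R" "s \<epsilon> R" "unit \<sqsubseteq> r" for a r b s
  proof (cases "a = b \<and> r = s")
    case False
    then show ?thesis
      using ge1[of a b r s] that le_trans[OF _ _ _ zero_le_one, of "level_dist Q a r b s"] in_R by simp
  qed (simp add: level_dist_def)
  have ge: "r \<sqsubseteq> level_dist Q a r b s" "s \<sqsubseteq> level_dist Q a r b s"
    if "\<not> (r = s \<and> Q a b)" "\<not> (a = b \<and> r = s)" "r \<epsilon> R" "s \<epsilon> R" for a r b s
    using that larger_ge by (auto simp: level_dist_def)
  let ?x = "level_dist Q a r b s" and ?y = "level_dist Q b s c t"
  have xy: "?x \<epsilon> R" "?y \<epsilon> R" "zer \<sqsubseteq> ?x" "zer \<sqsubseteq> ?y" using in_R nonneg levels by auto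
  consider "a = b \<and> r = s" | "b = c \<and> s = t" | "a = c \<and> r = t"
    | "\<not> (a = b \<and> r = s)" "\<not> (b = c \<and> s = t)" "\<not> (a = c \<and> r = t)" "r = t \<and> Q a c"
    | "\<not> (a = b \<and> r = s)" "\<not> (b = c \<and> s = t)" "\<not> (a = c \<and> r = t)" "\<not> (r = t \<and> Q a c)" by blast
  then show ?thesis
  proof cases
    case 1
    then have "?x = zer" by (simp add: level_dist_def)
    with 1 show ?thesis using xy by simp
  next
    case 2
    then have "?y = zer" by (simp add: level_dist_def)
    with 2 show ?thesis using xy by simp
  next
    case 3
    then have "level_dist Q a r c t = zer" by (simp add: level_dist_def)
    then show ?thesis using xy le_add_right[of zer ?x ?y] by simp
  next
    case 4
    then have "level_dist Q a r c t = unit" by (auto simp: level_dist_def)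
    then show ?thesis using xy le_add_right[of unit ?x ?y] ge1[OF 4(1)] levels by simp
  next
    case 5
    \<comment> \<open>If the first leg stays in its fibre, then \<open>s = r\<close> and, by
      transitivity of \<open>Q\<close>, the second leg leaves it.\<close>
    have "r \<sqsubseteq> ?x \<boxplus> ?y"
    proof (cases "r = s \<and> Q a b")
      case True
      then have "\<not> (s = t \<and> Q b c)" using 5 Q by blast
      then show ?thesis using ge(1)[of s t b c] 5 True levels xy le_add_left[of r ?x ?y] by auto
    next
      case False
      then show ?thesis using ge(1)[of r s a b] 5 levels xy le_add_right[of r ?x ?y] by auto
    qed
    moreover have "t \<sqsubseteq> ?x \<boxplus> ?y"
    proof (cases "s = t \<and> Q b c")
      case True
      then have "\<not> (r = s \<and> Q a b)" using 5 Q by blast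
      then show ?thesis using ge(2)[of r s a b] 5 True levels xy le_add_right[of t ?x ?y] by auto
    next
      case False
      then show ?thesis using ge(2)[of s t b c] 5 levels xy le_add_left[of t ?x ?y] by auto
    qed
    moreover have "level_dist Q a r c t = larger r t" using 5(3,4) by (auto simp: level_dist_def)
    ultimately show ?thesis by (simp add: larger_def)
  qed
qed

text \<open>The metric must be a set of the model. The first assumption on \<open>Q\<close> is
  phrased as an introduction rule for \<open>definable\<close>, so that it combines with the
  others.\<close>

lemma ex_level_metric:
  assumes Q: "\<And>s t. definable_term s \<Longrightarrow> definable_term t \<Longrightarrow> definable (\<lambda>e. Q (s e) (t e))"
    "\<And>a b. Q a b \<Longrightarrow> Q b a" "\<And>a b c. Q a b \<Longrightarrow> Q b c \<Longrightarrow> Q a c"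
    and L: "\<And>r. r \<epsilon> L \<longleftrightarrow> r \<epsilon> R \<and> unit \<sqsubseteq> r"
  obtains d where "metric (cprod A L) d"
    "\<And>a r b s. a \<epsilon> A \<Longrightarrow> r \<epsilon> L \<Longrightarrow> b \<epsilon> A \<Longrightarrow> s \<epsilon> L \<Longrightarrow>
      dist_in d (kpair a r) (kpair b s) = level_dist Q a r b s"
proof -
  let ?S = "cprod A L"
  \<comment> \<open>The conditionals of \<open>level_dist\<close> and \<open>larger\<close> spelled
    out as a disjunction, that is, as a formula.\<close>
  define P where "P = (\<lambda>x v. \<exists>a r b s. x = kpair (kpair a r) (kpair b s) \<and>
    (a = b \<and> r = s \<and> v = zer \<or> \<not> (a = b \<and> r = s) \<and> r = s \<and> Q a b \<and> v = unit \<or>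
     \<not> (a = b \<and> r = s) \<and> \<not> (r = s \<and> Q a b) \<and> (r \<sqsubseteq> s \<and> v = s \<or> \<not> r \<sqsubseteq> s \<and> v = r)))"
  have P: "P (kpair (kpair a r) (kpair b s)) v \<longleftrightarrow> v = level_dist Q a r b s" for a r b s v
    by (auto simp: P_def level_dist_def larger_def)
  have in_R: "level_dist Q a r b s \<epsilon> R" if "r \<epsilon> R" "s \<epsilon> R" for a r b s
    using that larger_ge by (auto simp: level_dist_def)
  have "definable (\<lambda>e. P (e 0) (e (Suc 0)))"
    unfolding P_def by (rule definable_intros Q(1))+
  moreover have "\<exists>y. y \<epsilon> R \<and> (\<forall>z. P x z \<longleftrightarrow> z = y)" if x: "x \<epsilon> cprod ?S ?S" for x
  proof -
    obtain a r b s where "x = kpair (kpair a r) (kpair b s)" "r \<epsilon> R" "s \<epsilon> R"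
      using x by (auto simp: mem_cprod L)
    then show ?thesis using in_R P by (intro exI[of _ "level_dist Q a r b s"]) simp
  qed
  ultimately obtain d where d: "is_fun d (cprod ?S ?S) R" "\<And>x. x \<epsilon> cprod ?S ?S \<Longrightarrow> P x (fapp d x)"
    using ex_fun[of P "cprod ?S ?S" R] by blast
  have dist: "dist_in d (kpair a r) (kpair b s) = level_dist Q a r b s"
    if "a \<epsilon> A" "r \<epsilon> L" "b \<epsilon> A" "s \<epsilon> L" for a r b s
    using d(2)[of "kpair (kpair a r) (kpair b s)"] that by (simp add: P)
  have nz: "zer \<noteq> larger r s \<and> zer \<sqsubseteq> larger r s" if "r \<epsilon> L" "s \<epsilon> L" for r s
  proof -
    have rs: "r \<epsilon> R" "s \<epsilon> R" "unit \<sqsubseteq> r" using that L by auto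
    then have 1: "unit \<sqsubseteq> larger r s"
      using larger_ge[OF rs(1,2)] le_trans[of unit r "larger r s"] by simp
    then have "zer \<sqsubseteq> larger r s"
      using larger_ge(1)[OF rs(1,2)] le_trans[OF _ _ _ zero_le_one, of "larger r s"] by simp
    then show ?thesis using 1 not_one_le_zero by metis
  qed
  have "metric ?S d"
    unfolding metric_def
  proof (intro conjI HOL.allI HOL.impI d(1))
    fix x y assume "x \<epsilon> ?S" "y \<epsilon> ?S"
    then obtain a r b s where xy: "x = kpair a r" "y = kpair b s" "a \<epsilon> A" "r \<epsilon> L" "b \<epsilon> A" "s \<epsilon> L"
      by (auto simp: mem_cprod)
    note dist = dist[OF xy(3-6)] dist[OF xy(5,6,3,4)]
    show "zer \<sqsubseteq> dist_in d x y"
      using nz[OF xy(4,6)] zero_le_one unfolding xy dist level_dist_def by simp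
    show "dist_in d x y = zer \<longleftrightarrow> x = y"
      using nz[OF xy(4,6)] zero_neq_one unfolding xy dist level_dist_def by auto
    show "dist_in d x y = dist_in d y x"
    proof -
      have "(b = a \<and> s = r) \<longleftrightarrow> (a = b \<and> r = s)" "(s = r \<and> Q b a) \<longleftrightarrow> (r = s \<and> Q a b)"
        using Q(2) by blast+
      moreover have "larger r s = larger s r" using larger_comm xy(4,6) by (simp add: L)
      ultimately show ?thesis unfolding xy dist level_dist_def by simp
    qed
  next
    fix x y z assume "x \<epsilon> ?S" "y \<epsilon> ?S" "z \<epsilon> ?S"
    then obtain a r b s c t where xyz: "x = kpair a r" "y = kpair b s" "z = kpair c t"
      "a \<epsilon> A" "r \<epsilon> L" "b \<epsilon> A" "s \<epsilon> L" "c \<epsilon> A" "t \<epsilon> L"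
      by (auto simp: mem_cprod)
    show "dist_in d x z \<sqsubseteq> dist_in d x y \<boxplus> dist_in d y z"
      unfolding xyz(1-3) dist[OF xyz(4-7)] dist[OF xyz(4,5,8,9)] dist[OF xyz(6-9)]
      by (rule level_dist_triangle[OF Q(2,3)]) (use xyz in \<open>simp_all add: L\<close>)
  qed
  with dist show thesis using that by blast
qed

end

section \<open>Choice from a reversed quasi-isometry\<close>

lemma (in zf_model) holds_axiom_of_choice:
  "holds d e axiom_of_choice \<longleftrightarrow> (\<forall>Z.
    (\<exists>X. X \<epsilon> Z) \<and> (\<forall>X. X \<epsilon> Z \<longrightarrow> (\<exists>x. x \<epsilon> X)) \<and>
    (\<forall>X. X \<epsilon> Z \<longrightarrow> (\<forall>Y. Y \<epsilon> Z \<longrightarrow> X \<noteq> Y \<longrightarrow> (\<forall>x. x \<epsilon> X \<longrightarrow> \<not> x \<epsilon> Y))) \<longrightarrow>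
    (\<exists>A. \<forall>X. X \<epsilon> Z \<longrightarrow> (\<exists>a. \<forall>x. x \<epsilon> A \<and> x \<epsilon> X \<longleftrightarrow> x = a)))"
  by (simp add: axiom_of_choice_def cong del: imp_cong)

context real_field
begin

text \<open>The constant is \<open>unit\<close>, for which \<open>coarse_bounds\<close> asks only
  for additive errors of one; by surjectivity every point of \<open>T\<close> is at distance zero
  from the image.\<close>

lemma coarse_equivI:
  assumes "metric S d" "metric T e" and f: "is_fun f S T" "\<And>t. t \<epsilon> T \<Longrightarrow> \<exists>x. x \<epsilon> S \<and> t = fapp f x"
    and bounds: "\<And>x y. x \<epsilon> S \<Longrightarrow> y \<epsilon> S \<Longrightarrow> dist_in d x y \<sqsubseteq> dist_in e (fapp f x) (fapp f y) \<boxplus> unit"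
    "\<And>x y. x \<epsilon> S \<Longrightarrow> y \<epsilon> S \<Longrightarrow> dist_in e (fapp f x) (fapp f y) \<sqsubseteq> dist_in d x y \<boxplus> unit"
  shows "coarse_equiv S d T e f"
proof -
  have one_mult: "unit \<boxtimes> x = x" if "x \<epsilon> R" for x
    using that mult_comm[of unit x] by simp
  have f_in: "fapp f x \<epsilon> T" if "x \<epsilon> S" for x using is_fun_fapp[OF f(1)] that by blast
  have "\<And>y. y \<epsilon> T \<longleftrightarrow> (\<exists>x. x \<epsilon> S \<and> y = fapp f x)" using f_in f(2) by blast
  moreover have "near e T unit y" if "y \<epsilon> T" for y
    using near_self[OF assms(2) _ that] by blast
  moreover have "coarse_bounds S d e f unit"
    unfolding coarse_bounds_def
    using bounds f_in metricD(1)[OF assms(1)] metricD(1)[OF assms(2)] by (simp add: one_mult)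
  ultimately show ?thesis
    unfolding coarse_equiv_def using f(1) positive_nat_one by blast
qed

lemma choice_set:
  assumes sym: "\<And>S d T e f. metric S d \<Longrightarrow> metric T e \<Longrightarrow> coarse_equiv S d T e f \<Longrightarrow>
      \<exists>g. coarse_equiv T e S d g"
    and nonempty: "\<And>X. X \<epsilon> Z \<Longrightarrow> \<exists>x. x \<epsilon> X"
    and disjoint: "\<And>X Y x. X \<epsilon> Z \<Longrightarrow> Y \<epsilon> Z \<Longrightarrow> x \<epsilon> X \<Longrightarrow> x \<epsilon> Y \<Longrightarrow> X = Y"
  shows "\<exists>A. \<forall>X. X \<epsilon> Z \<longrightarrow> (\<exists>a. \<forall>x. x \<epsilon> A \<and> x \<epsilon> X \<longleftrightarrow> x = a)"
proof -

  \<comment> \<open>The two levelled spaces\<close>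
  obtain U where U: "\<And>x. x \<epsilon> U \<longleftrightarrow> (\<exists>X. X \<epsilon> Z \<and> x \<epsilon> X)" using union by blast
  have "definable (\<lambda>e. unit \<sqsubseteq> e 0)" by (rule definable_intros)+
  then obtain L where L: "\<And>r. r \<epsilon> L \<longleftrightarrow> r \<epsilon> R \<and> unit \<sqsubseteq> r"
    using separation[of "\<lambda>x. unit \<sqsubseteq> x" R] by blast
  define S where "S = cprod U L"
  define T where "T = cprod Z L"
  define Q where "Q = (\<lambda>x y. \<exists>X. X \<epsilon> Z \<and> x \<epsilon> X \<and> y \<epsilon> X)"
  have "definable (\<lambda>e. Q (s e) (t e))" if "definable_term s" "definable_term t" for s t
    unfolding Q_def by (rule definable_intros that[THEN definable_term_shift])+
  moreover have "Q a b \<Longrightarrow> Q b a" "Q a b \<Longrightarrow> Q b c \<Longrightarrow> Q a c" for a b c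
    unfolding Q_def using disjoint by blast+
  ultimately obtain d where d: "metric S d" "\<And>a r b s. a \<epsilon> U \<Longrightarrow> r \<epsilon> L \<Longrightarrow> b \<epsilon> U \<Longrightarrow> s \<epsilon> L \<Longrightarrow>
      dist_in d (kpair a r) (kpair b s) = level_dist Q a r b s"
    using ex_level_metric[of Q L U] L unfolding S_def by blast
  have "definable (\<lambda>e. s e = t e)" if "definable_term s" "definable_term t" for s t
    using that by (rule definable_eq)
  then obtain e where e: "metric T e" "\<And>a r b s. a \<epsilon> Z \<Longrightarrow> r \<epsilon> L \<Longrightarrow> b \<epsilon> Z \<Longrightarrow> s \<epsilon> L \<Longrightarrow>
      dist_in e (kpair a r) (kpair b s) = level_dist (=) a r b s"
    using ex_level_metric[of "(=)" L Z] L unfolding T_def by blast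

  \<comment> \<open>The projection and its effect on distances\<close>
  define P where "P = (\<lambda>p q. \<exists>x r X. p = kpair x r \<and> q = kpair X r \<and> x \<epsilon> X \<and> X \<epsilon> Z)"
  have "definable (\<lambda>e. P (e 0) (e (Suc 0)))"
    unfolding P_def by (rule definable_intros)+
  moreover have "\<exists>y. y \<epsilon> T \<and> (\<forall>z. P p z \<longleftrightarrow> z = y)" if p: "p \<epsilon> S" for p
  proof -
    obtain x r X where "p = kpair x r" "r \<epsilon> L" "X \<epsilon> Z" "x \<epsilon> X"
      using p by (auto simp: S_def mem_cprod U)
    then show ?thesis
      using disjoint by (intro exI[of _ "kpair X r"]) (auto simp: P_def T_def)
  qed
  ultimately obtain f where f: "is_fun f S T" "\<And>p. p \<epsilon> S \<Longrightarrow> P p (fapp f p)"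
    using ex_fun[of P S T] by blast
  have f_eq: "fapp f (kpair x r) = kpair X r" if "x \<epsilon> X" "X \<epsilon> Z" "r \<epsilon> L" for x X r
  proof -
    have "kpair x r \<epsilon> S" using that by (auto simp: S_def U)
    then have "P (kpair x r) (fapp f (kpair x r))" by (rule f(2))
    then show ?thesis using that disjoint by (auto simp: P_def)
  qed
  have point: "\<exists>x r X. p = kpair x r \<and> r \<epsilon> L \<and> X \<epsilon> Z \<and> x \<epsilon> X \<and> x \<epsilon> U \<and> fapp f p = kpair X r"
    if p: "p \<epsilon> S" for p
  proof -
    obtain x r X where "p = kpair x r" "r \<epsilon> L" "X \<epsilon> Z" "x \<epsilon> X"
      using p by (auto simp: S_def mem_cprod U)
    then show ?thesis using f_eq U by blast
  qed
  have Q_iff: "Q x y \<longleftrightarrow> X = Y" if "x \<epsilon> X" "X \<epsilon> Z" "y \<epsilon> Y" "Y \<epsilon> Z" for x y X Y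
    unfolding Q_def using disjoint that by blast

  have f_in: "fapp f p \<epsilon> T" if "p \<epsilon> S" for p using is_fun_fapp[OF f(1)] that by blast
  have d_fibre: "dist_in d p q \<sqsubseteq> unit" if pq: "p \<epsilon> S" "q \<epsilon> S" "fapp f p = fapp f q" for p q
  proof -
    obtain x r X where x: "p = kpair x r" "r \<epsilon> L" "X \<epsilon> Z" "x \<epsilon> X" "x \<epsilon> U" "fapp f p = kpair X r"
      using point[OF pq(1)] by blast
    obtain y s Y where y: "q = kpair y s" "s \<epsilon> L" "Y \<epsilon> Z" "y \<epsilon> Y" "y \<epsilon> U" "fapp f q = kpair Y s"
      using point[OF pq(2)] by blast
    have "dist_in d p q = level_dist Q x r y s" using d(2) x y by simp
    moreover have "r = s" "X = Y" using x(6) y(6) pq(3) by simp_all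
    moreover have "Q x y" using Q_iff x(3,4) y(3,4) \<open>X = Y\<close> by blast
    ultimately show ?thesis using zero_le_one by (simp add: level_dist_def)
  qed
  \<comment> \<open>Between different fibres both distances are the larger of the two levels, so the
    projection preserves them exactly.\<close>
  have d_eq: "dist_in d p q = dist_in e (fapp f p) (fapp f q)"
    if pq: "p \<epsilon> S" "q \<epsilon> S" "fapp f p \<noteq> fapp f q" for p q
  proof -
    obtain x r X where x: "p = kpair x r" "r \<epsilon> L" "X \<epsilon> Z" "x \<epsilon> X" "x \<epsilon> U" "fapp f p = kpair X r"
      using point[OF pq(1)] by blast
    obtain y s Y where y: "q = kpair y s" "s \<epsilon> L" "Y \<epsilon> Z" "y \<epsilon> Y" "y \<epsilon> U" "fapp f q = kpair Y s"
      using point[OF pq(2)] by blast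
    have "dist_in d p q = level_dist Q x r y s" "dist_in e (fapp f p) (fapp f q) = level_dist (=) X r Y s"
      using d(2) e(2) x y by simp_all
    moreover have ne: "\<not> (X = Y \<and> r = s)" using x(6) y(6) pq(3) by auto
    moreover have "Q x y \<longleftrightarrow> X = Y" using Q_iff x(3,4) y(3,4) by blast
    moreover have "\<not> (x = y \<and> r = s)" using ne disjoint x(3,4) y(3,4) by blast
    ultimately show ?thesis by (auto simp: level_dist_def)
  qed
  have "coarse_equiv S d T e f"
  proof (rule coarse_equivI[OF d(1) e(1) f(1)])
    show "\<exists>p. p \<epsilon> S \<and> t = fapp f p" if t: "t \<epsilon> T" for t
    proof -
      obtain X r where X: "t = kpair X r" "X \<epsilon> Z" "r \<epsilon> L" using t by (auto simp: T_def mem_cprod)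
      moreover obtain x where x: "x \<epsilon> X" using nonempty X by blast
      ultimately show ?thesis
        using f_eq[OF x] U by (intro exI[of _ "kpair x r"]) (auto simp: S_def)
    qed
    fix p q assume pq: "p \<epsilon> S" "q \<epsilon> S"
    note in_R = metricD(1)[OF d(1) pq] metricD(1)[OF e(1) f_in[OF pq(1)] f_in[OF pq(2)]]
    note nonneg = metricD(2)[OF d(1) pq] metricD(2)[OF e(1) f_in[OF pq(1)] f_in[OF pq(2)]]
    show "dist_in d p q \<sqsubseteq> dist_in e (fapp f p) (fapp f q) \<boxplus> unit"
    proof (cases "fapp f p = fapp f q")
      case True
      then show ?thesis using d_fibre[OF pq] in_R nonneg by (intro le_add_left) simp_all
    next
      case False
      then show ?thesis using d_eq[OF pq] in_R zero_le_one by (simp add: le_add)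
    qed
    show "dist_in e (fapp f p) (fapp f q) \<sqsubseteq> dist_in d p q \<boxplus> unit"
    proof (cases "fapp f p = fapp f q")
      case True
      then have "dist_in e (fapp f p) (fapp f q) = zer"
        using metricD(3)[OF e(1) f_in[OF pq(1)] f_in[OF pq(2)]] by blast
      then show ?thesis using in_R nonneg zero_le_one by (simp add: le_add_right)
    next
      case False
      then show ?thesis using d_eq[OF pq] in_R zero_le_one by (simp add: le_add)
    qed
  qed

  \<comment> \<open>The reversed quasi-isometry\<close>
  then obtain g where g: "coarse_equiv T e S d g" using sym[OF d(1) e(1)] by blast
  then obtain n J where fun_g: "is_fun g T S" and "positive_nat n"
    and J: "\<And>y. y \<epsilon> J \<longleftrightarrow> (\<exists>t. t \<epsilon> T \<and> y = fapp g t)" "\<And>y. y \<epsilon> S \<Longrightarrow> near d J n y"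
    and bounds: "coarse_bounds T e d g n"
    unfolding coarse_equiv_def by blast
  note n = one_le_positive_nat[OF \<open>positive_nat n\<close>]
  have n0: "zer \<sqsubseteq> n" using n zero_le_one le_trans[of zer unit n] by simp
  have g_in: "fapp g t \<epsilon> S" if "t \<epsilon> T" for t using is_fun_fapp[OF fun_g] that by blast

  have e_ge: "r \<sqsubseteq> dist_in e t t'"
    if t: "t = kpair X r" "t \<epsilon> T" "t' \<epsilon> T" "t \<noteq> t'" for t t' X r
  proof -
    obtain Y s where Y: "t' = kpair Y s" "Y \<epsilon> Z" "s \<epsilon> L" using t(3) by (auto simp: T_def mem_cprod)
    have X: "X \<epsilon> Z" "r \<epsilon> L" using t(1,2) by (auto simp: T_def)
    have "dist_in e t t' = larger r s" unfolding t(1) Y(1) e(2)[OF X Y(2,3)]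
      using t(4) unfolding t(1) Y(1) by (auto simp: level_dist_def)
    then show ?thesis using larger_ge X Y L by simp
  qed
  have e_le: "dist_in e t t' \<sqsubseteq> c"
    if t: "t = kpair X r" "t' = kpair Y s" "t \<epsilon> T" "t' \<epsilon> T" and c: "r \<sqsubseteq> c" "s \<sqsubseteq> c" "zer \<sqsubseteq> c"
    for t t' X Y r s c
  proof -
    have X: "X \<epsilon> Z" "r \<epsilon> L" "Y \<epsilon> Z" "s \<epsilon> L" using t by (auto simp: T_def)
    show ?thesis unfolding t(1,2) e(2)[OF X]
      using c by (auto simp: level_dist_def larger_def)
  qed

  have hit: "\<exists>t. t \<epsilon> T \<and> fapp f (fapp g t) = kpair X r"
    if X: "X \<epsilon> Z" "r \<epsilon> L" "n \<boxplus> unit \<sqsubseteq> r" for X r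
  proof -
    obtain x where x: "x \<epsilon> X" using nonempty X by blast
    define p where "p = kpair x r"
    have p: "p \<epsilon> S" "fapp f p = kpair X r" using f_eq x X U by (auto simp: p_def S_def)
    have "y \<epsilon> S" if "y \<epsilon> J" for y
      using that g_in unfolding J(1) by auto
    from near_imp[OF d(1) this p(1) n(1) J(2)[OF p(1)]]
    obtain y where "y \<epsilon> J" and y: "\<not> n \<boxplus> unit \<sqsubseteq> dist_in d p y"
      by blast
    then obtain t where t: "t \<epsilon> T" "y = fapp g t" using J(1) by blast
    then have far: "\<not> n \<boxplus> unit \<sqsubseteq> dist_in d p (fapp g t)" using y by simp
    have "fapp f p = fapp f (fapp g t)"
    proof (rule ccontr)
      assume ne: "fapp f p \<noteq> fapp f (fapp g t)"
      then have "r \<sqsubseteq> dist_in d p (fapp g t)"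
        unfolding d_eq[OF p(1) g_in[OF t(1)] ne]
        using e_ge[OF p(2) f_in[OF p(1)] f_in[OF g_in[OF t(1)]]] by blast
      then have "n \<boxplus> unit \<sqsubseteq> dist_in d p (fapp g t)"
        using le_trans[OF _ _ _ X(3)] X(2) L n metricD(1)[OF d(1) p(1) g_in[OF t(1)]] by simp
      with far show False ..
    qed
    then show ?thesis using p(2) t(1) by auto
  qed

  \<comment> \<open>Points sent by \<open>g\<close> into one fibre have images at distance at most
    \<open>unit\<close>, so the lower bound puts them within \<open>c\<close> of each other. Points
    of level at most \<open>c\<close> are within \<open>c\<close> of each other, so by the upper
    bound their images are within \<open>m\<close>.\<close>
  define c where "c = n \<boxtimes> (unit \<boxplus> n)"
  define m where "m = n \<boxtimes> c \<boxplus> n"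
  have c_in: "c \<epsilon> R" and m_in: "m \<epsilon> R" using n by (simp_all add: c_def m_def)
  have c0: "zer \<sqsubseteq> c"
    unfolding c_def using n n0 zero_le_one le_add_right[of zer unit n] by (intro mult_nonneg) simp_all
  have m0: "zer \<sqsubseteq> m"
    unfolding m_def using n n0 c0 c_in by (intro le_add_right mult_nonneg) simp_all
  have low: "r \<sqsubseteq> c"
    if t: "t \<epsilon> T" "t' \<epsilon> T" "t \<noteq> t'" "fapp f (fapp g t) = fapp f (fapp g t')" "t = kpair X r"
    for t t' X r
  proof -
    have X: "r \<epsilon> R" using t(1,5) by (simp add: T_def L)
    note in_R = metricD(1)[OF e(1) t(1,2)] metricD(1)[OF d(1) g_in[OF t(1)] g_in[OF t(2)]]
    have "dist_in d (fapp g t) (fapp g t') \<boxplus> n \<sqsubseteq> unit \<boxplus> n"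
      using d_fibre[OF g_in[OF t(1)] g_in[OF t(2)] t(4)] in_R n by (intro add_mono) simp_all
    then have "n \<boxtimes> (dist_in d (fapp g t) (fapp g t') \<boxplus> n) \<sqsubseteq> c"
      unfolding c_def using in_R n n0 by (intro mult_left_mono) simp_all
    moreover have "dist_in e t t' \<sqsubseteq> n \<boxtimes> (dist_in d (fapp g t) (fapp g t') \<boxplus> n)"
      using bounds t(1,2) unfolding coarse_bounds_def by blast
    ultimately have "dist_in e t t' \<sqsubseteq> c"
      using le_trans[of "dist_in e t t'" "n \<boxtimes> (dist_in d (fapp g t) (fapp g t') \<boxplus> n)" c]
        in_R n c_in by simp
    then show ?thesis
      using e_ge[OF t(5,1,2,3)] le_trans[of r "dist_in e t t'" c] X in_R c_in by simp
  qed
  have far: "r \<sqsubseteq> m"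
    if t: "t \<epsilon> T" "t' \<epsilon> T" "t = kpair X i" "t' = kpair Y j" "i \<sqsubseteq> c" "j \<sqsubseteq> c"
      "fapp f (fapp g t) = kpair V r" "fapp f (fapp g t) \<noteq> fapp f (fapp g t')"
    for t t' X Y i j V r
  proof -
    note in_R = metricD(1)[OF e(1) t(1,2)] metricD(1)[OF d(1) g_in[OF t(1)] g_in[OF t(2)]]
    note fg_in = f_in[OF g_in[OF t(1)]] f_in[OF g_in[OF t(2)]]
    have r: "r \<epsilon> R" using fg_in(1) unfolding t(7) by (simp add: T_def L)
    have "n \<boxtimes> dist_in e t t' \<boxplus> n \<sqsubseteq> m"
      unfolding m_def using e_le[OF t(3,4,1,2,5,6) c0] in_R n n0 c_in
      by (intro add_mono mult_left_mono) simp_all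
    moreover have "dist_in d (fapp g t) (fapp g t') \<sqsubseteq> n \<boxtimes> dist_in e t t' \<boxplus> n"
      using bounds t(1,2) unfolding coarse_bounds_def by blast
    ultimately have "dist_in d (fapp g t) (fapp g t') \<sqsubseteq> m"
      using le_trans[of "dist_in d (fapp g t) (fapp g t')" "n \<boxtimes> dist_in e t t' \<boxplus> n" m]
        in_R n m_in by simp
    moreover have "r \<sqsubseteq> dist_in d (fapp g t) (fapp g t')"
      unfolding d_eq[OF g_in[OF t(1)] g_in[OF t(2)] t(8)]
      using e_ge[OF t(7) fg_in t(8)] .
    ultimately show ?thesis
      using le_trans[of r "dist_in d (fapp g t) (fapp g t')" m] r in_R m_in by simp
  qed

  \<comment> \<open>A level at which no fibre is hit twice\<close>
  let ?good = "\<lambda>k. \<forall>X t t'. t \<epsilon> T \<longrightarrow> t' \<epsilon> T \<longrightarrow> fapp f (fapp g t) = kpair X k \<longrightarrow>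
    fapp f (fapp g t') = kpair X k \<longrightarrow> t = t'"
  \<comment> \<open>The summand \<open>n \<boxplus> unit\<close> makes \<open>hit\<close> applicable
    at level \<open>k\<close>, and together with \<open>m\<close> it lifts \<open>k\<close> strictly
    above \<open>m\<close>.\<close>
  define k where "k = m \<boxplus> (n \<boxplus> unit)"
  have k: "k \<epsilon> R" "n \<boxplus> unit \<sqsubseteq> k"
    unfolding k_def using n m_in m0 le_add_left[of "n \<boxplus> unit" m "n \<boxplus> unit"] by simp_all
  have "unit \<sqsubseteq> n \<boxplus> unit" using n n0 by (intro le_add_left) simp_all
  then have k1: "unit \<sqsubseteq> k" using le_trans[OF _ _ _ _ k(2), of unit] k(1) n by simp
  have "\<not> k \<sqsubseteq> m"
  proof
    assume "k \<sqsubseteq> m"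
    moreover have "m \<boxplus> unit \<sqsubseteq> k"
      unfolding k_def using n m_in \<open>unit \<sqsubseteq> n \<boxplus> unit\<close> by (intro add_mono2) simp_all
    ultimately show False
      using le_trans[of "m \<boxplus> unit" k m] k m_in not_add_one_le[of m] by simp
  qed
  \<comment> \<open>Testing two levels avoids locating the exceptional fibre: twice-hit fibres at
    both levels would be distinct and hit from level at most \<open>c\<close>, and
    \<open>far\<close> would give \<open>k \<sqsubseteq> m\<close>.\<close>
  have "?good k \<or> ?good (k \<boxplus> unit)"
  proof (rule ccontr)
    assume "\<not> ?thesis"
    then obtain X t t' Y u u' where t: "t \<epsilon> T" "t' \<epsilon> T" "fapp f (fapp g t) = kpair X k"
        "fapp f (fapp g t') = kpair X k" "t \<noteq> t'"
      and u: "u \<epsilon> T" "u' \<epsilon> T" "fapp f (fapp g u) = kpair Y (k \<boxplus> unit)"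
        "fapp f (fapp g u') = kpair Y (k \<boxplus> unit)" "u \<noteq> u'"
      by blast
    obtain A i where A: "t = kpair A i" using t(1) by (auto simp: T_def mem_cprod)
    obtain B j where B: "u = kpair B j" using u(1) by (auto simp: T_def mem_cprod)
    have "i \<sqsubseteq> c" using low[OF t(1,2,5) _ A] t(3,4) by simp
    moreover have "j \<sqsubseteq> c" using low[OF u(1,2,5) _ B] u(3,4) by simp
    moreover have "k \<noteq> k \<boxplus> unit" using not_add_one_le[OF k(1)] k(1) le_refl[of k] by metis
    then have "fapp f (fapp g t) \<noteq> fapp f (fapp g u)" using t(3) u(3) by simp
    ultimately have "k \<sqsubseteq> m" using far[OF t(1) u(1) A B _ _ t(3)] by blast
    then show False using \<open>\<not> k \<sqsubseteq> m\<close> by blast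
  qed
  moreover have "n \<boxplus> unit \<sqsubseteq> k \<boxplus> unit" "unit \<sqsubseteq> k \<boxplus> unit"
    using k k1 n zero_le_one by (simp_all add: le_add_right)
  ultimately obtain h where h: "h \<epsilon> L" "n \<boxplus> unit \<sqsubseteq> h" "?good h"
    using k k1 L by (metis add_in one_in)

  \<comment> \<open>The first components of the values of \<open>g\<close> at level
    \<open>h\<close>: a formula in the parameters \<open>g\<close> and \<open>h\<close>, so the
    selection made by \<open>g\<close> becomes a set of the model.\<close>
  have "definable (\<lambda>e. \<exists>t. kpair t (kpair (e 0) h) \<epsilon> g)" by (rule definable_intros)+
  then obtain A where A: "\<And>x. x \<epsilon> A \<longleftrightarrow> x \<epsilon> U \<and> (\<exists>t. kpair t (kpair x h) \<epsilon> g)"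
    using separation[of "\<lambda>x. \<exists>t. kpair t (kpair x h) \<epsilon> g" U] by blast
  have "\<exists>a. \<forall>x. x \<epsilon> A \<and> x \<epsilon> X \<longleftrightarrow> x = a" if X: "X \<epsilon> Z" for X
  proof -
    obtain t where t: "t \<epsilon> T" "fapp f (fapp g t) = kpair X h" using hit[OF X h(1,2)] by blast
    obtain a where a: "fapp g t = kpair a h" "a \<epsilon> X" "a \<epsilon> U"
      using point[OF g_in[OF t(1)]] t(2) by auto
    have "a \<epsilon> A" unfolding A is_fun_graph[OF fun_g] using a t(1) by auto
    moreover have "x = a" if x: "x \<epsilon> A" "x \<epsilon> X" for x
    proof -
      obtain t' where t': "t' \<epsilon> T" "kpair x h = fapp g t'"
        using x(1) unfolding A is_fun_graph[OF fun_g] by blast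
      then have "fapp f (fapp g t') = kpair X h" using f_eq[OF x(2) X h(1)] by simp
      then have "t' = t" using h(3) t t'(1) by blast
      then show ?thesis using t'(2) a(1) by simp
    qed
    ultimately show ?thesis using a(2) by blast
  qed
  then show ?thesis by blast
qed

end

theorem corollary2:
  shows "ZF \<turnstile> sentence (\<^bold>\<forall>R plus times le o0 o1. let K = Reals R plus times le o0 o1 in
    complete_ordered_field K \<^bold>\<longrightarrow> quasi_isometry_symmetric K \<^bold>\<longrightarrow> axiom_of_choice)"
proof (rule ZF_complete)
  fix E :: "nat \<Rightarrow> nat \<Rightarrow> bool" and outer
  assume ZF: "\<forall>q\<in>ZF. sat (=) E outer q"
  interpret zf_model E outer
  proof
    show "x = y" if "\<And>z. E z x \<longleftrightarrow> E z y" for x y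
      using sat_extensionality[OF ZF that] .
  qed (fact sat_pairing[OF ZF] sat_union[OF ZF] sat_power_set[OF ZF] sat_separation[OF ZF])+
  \<comment> \<open>The six outer quantifiers bind the levels 0 to 5 in this order, so the body is
    evaluated at depth 6.\<close>
  let ?K = "Reals 0 (Suc 0) (Suc (Suc 0)) (Suc (Suc (Suc 0))) (Suc (Suc (Suc (Suc 0))))
    (Suc (Suc (Suc (Suc (Suc 0)))))"
  let ?d = "Suc (Suc (Suc (Suc (Suc (Suc 0)))))"
  have "holds ?d e axiom_of_choice"
    if field: "holds ?d e (complete_ordered_field ?K)"
      and sym: "holds ?d e (quasi_isometry_symmetric ?K)" for e
  proof -
    have K: "interprets ?d e ?K (e (carrier ?K)) (e (add ?K)) (e (mul ?K)) (e (leq ?K))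
        (e (zero ?K)) (e (one ?K))"
      by (simp add: interprets_def)
    interpret real_field E outer "e (carrier ?K)" "e (add ?K)" "e (mul ?K)" "e (leq ?K)"
        "e (zero ?K)" "e (one ?K)"
      using real_field[OF K field] .
    have sym': "\<exists>g. coarse_equiv T b S a g"
      if "metric S a" "metric T b" "coarse_equiv S a T b f" for S a T b f
    proof -
      \<comment> \<open>The translation of quasi-isometries is conditional on both spaces being
        metric, which the premise of symmetry supplies.\<close>
      have "\<forall>S a T b. metric S a \<and> metric T b \<longrightarrow> (\<exists>f. coarse_equiv S a T b f) \<longrightarrow>
          (\<exists>g. coarse_equiv T b S a g)"
        using sym by (simp add: quasi_isometry_symmetric_def interprets_def holds_metric_space
            holds_quasi_isometry)
      then show ?thesis using that by blast
    qed
    have AC: "\<exists>A. \<forall>X. E X Z \<longrightarrow> (\<exists>a. \<forall>x. E x A \<and> E x X \<longleftrightarrow> x = a)"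
      if nonempty: "\<forall>X. E X Z \<longrightarrow> (\<exists>x. E x X)"
        and disjoint: "\<forall>X. E X Z \<longrightarrow> (\<forall>Y. E Y Z \<longrightarrow> X \<noteq> Y \<longrightarrow> (\<forall>x. E x X \<longrightarrow> \<not> E x Y))" for Z
    proof (rule choice_set)
      show "\<exists>x. E x X" if "E X Z" for X using nonempty that by blast
      show "X = Y" if "E X Z" "E Y Z" "E x X" "E x Y" for X Y x
        using disjoint that by blast
    qed (fact sym')
    then show ?thesis unfolding holds_axiom_of_choice by blast
  qed
  then show "sat (=) E outer (sentence (\<^bold>\<forall>R plus times le o0 o1.
      let K = Reals R plus times le o0 o1 in
      complete_ordered_field K \<^bold>\<longrightarrow> quasi_isometry_symmetric K \<^bold>\<longrightarrow> axiom_of_choice))"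
    unfolding holds_sentence[where e = outer, symmetric] by (simp add: Let_def)
qed

end
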